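(* Let $\mathbb K$ be a field and $d\ge0$ an integer. The map which sends a TH system $(A;\{E_i\}_{i=0}^d;A^*;\{E_i^*\}_{i=0}^d)$ to its reduction $(\{E_i\}_{i=0}^d;\{E_i^*\}_{i=0}^d)$ induces a bijection from the set of affine isomorphism classes of TH systems over $\mathbb K$ of diameter $d$ to the set of isomorphism classes of RTH systems over $\mathbb K$ of diameter $d$.
   Context: The symbol $*$ is only notation. Let $V$ be a $\mathbb K$-vector space of dimension $d+1$. An element of $\mathrm{End}(V)$ is multiplicity-free if it is diagonalizable and all its eigenspaces have dimension one; the primitive idempotent attached to an eigenspace acts as the identity on it and as $0$ on the other eigenspaces. A TH system on $V$ (of diameter $d$, over $\mathbb K$) is a sequence $\Phi=(A;\{E_i\}_{i=0}^d;A^*;\{E^*_i\}_{i=0}^d)$ such that $A,A^*\in\mathrm{End}(V)$ are multiplicity-free; $\{E_i\}$ (resp. $\{E_i^*\}$) is an ordering of the primitive idempotents of $A$ (resp. $A^*$); and for $0\le i,j\le d$, each of $E_iA^*E_j$ and $E^*_iAE^*_j$ is $0$ if $i-j>1$ and nonzero if $i-j=1$. TH systems $(A;\{E_i\};A^*;\{E_i^*\})$ on $V$ and $(B;\{F_i\};B^*;\{F_i^*\})$ on $W$ ($\dim W=d+1$) are isomorphic if there is a $\mathbb K$-algebra isomorphism $\gamma:\mathrm{End}(V)\to\mathrm{End}(W)$ with $B=A^\gamma$, $B^*=A^{*\gamma}$, $F_i=E_i^\gamma$, $F_i^*=E_i^{*\gamma}$ for all $i$. An affine transformation of $\Phi$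 is a TH system $(\alpha A+\beta I;\{E_i\};\alpha^*A^*+\beta^*I;\{E_i^*\})$ with $\alpha,\beta,\alpha^*,\beta^*\in\mathbb K$ and $\alpha,\alpha^*$ nonzero. $\Phi$ and $\Phi'$ are affine isomorphic if $\Phi$ is isomorphic to an affine transformation of $\Phi'$; this is an equivalence relation. A sequence $(\{E_i\}_{i=0}^d;\{E_i^*\}_{i=0}^d)$ is an RTH (reduced TH) system on $V$ if there exist $A,A^*\in\mathrm{End}(V)$ such that $(A;\{E_i\};A^*;\{E_i^*\})$ is a TH system on $V$; it is called the reduction of that TH system. RTH systems $(\{E_i\};\{E_i^*\})$ on $V$ and $(\{F_i\};\{F_i^*\})$ on $W$ are isomorphic if there is a $\mathbb K$-algebra isomorphism $\gamma:\mathrm{End}(V)\to\mathrm{End}(W)$ with $F_i=E_i^\gamma$ and $F_i^*=E_i^{*\gamma}$ for all $i$. *)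

theory Defs
  imports "Jordan_Normal_Form.Missing_VectorSpace" "HOL-Algebra.QuotRing"
begin

text \<open>
  Vector spaces are those of the locale \<open>vectorspace K V\<close>: arbitrary carrier set in a type of
  vectors \<open>'v\<close>, with its own addition and scalar multiplication. Each isomorphism class below is a
  class of systems on all spaces \<open>V\<close> with carrier inside \<open>'v\<close>; the type variable \<open>'v\<close> plays
  the role of a universe and is left arbitrary.
\<close>

text \<open>
  Endomorphisms are made \<^emph>\<open>extensional\<close> on the carrier, so that equality of elements of the
  algebra is equality of functions.
\<close>

definition End_alg :: "('k, 'm) ring_scheme \<Rightarrow> ('k, 'v) module \<Rightarrow> ('k, 'v \<Rightarrow> 'v) module" where
  "End_alg K V =
    \<lparr> carrier = module_hom K V V \<inter> extensional (carrier V),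
      mult = compose (carrier V),
      one = (\<lambda>v \<in> carrier V. v),
      zero = (\<lambda>v \<in> carrier V. \<zero>\<^bsub>V\<^esub>),
      add = (\<lambda>S T. \<lambda>v \<in> carrier V. S v \<oplus>\<^bsub>V\<^esub> T v),
      smult = (\<lambda>c T. \<lambda>v \<in> carrier V. c \<odot>\<^bsub>V\<^esub> T v) \<rparr>"

definition End_alg_iso ::
  "('k, 'm) ring_scheme \<Rightarrow> ('k, 'v) module \<Rightarrow> ('k, 'w) module \<Rightarrow> (('v \<Rightarrow> 'v) \<Rightarrow> ('w \<Rightarrow> 'w)) set" where
  "End_alg_iso K V W =
    ring_iso (End_alg K V) (End_alg K W) \<inter> module_hom K (End_alg K V) (End_alg K W)"

definition eigenspace :: "('k, 'v) module \<Rightarrow> ('v \<Rightarrow> 'v) \<Rightarrow> 'k \<Rightarrow> 'v set" where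
  "eigenspace V A \<theta> = {v \<in> carrier V. A v = \<theta> \<odot>\<^bsub>V\<^esub> v}"

definition eigenvalues :: "('k, 'm) ring_scheme \<Rightarrow> ('k, 'v) module \<Rightarrow> ('v \<Rightarrow> 'v) \<Rightarrow> 'k set" where
  "eigenvalues K V A = {\<theta> \<in> carrier K. \<exists>v \<in> eigenspace V A \<theta>. v \<noteq> \<zero>\<^bsub>V\<^esub>}"

definition diagonalizable :: "('k, 'm) ring_scheme \<Rightarrow> ('k, 'v) module \<Rightarrow> ('v \<Rightarrow> 'v) \<Rightarrow> bool" where
  "diagonalizable K V A \<longleftrightarrow>
    (\<exists>B. vectorspace.basis K V B \<and> (\<forall>v \<in> B. \<exists>\<theta> \<in> carrier K. v \<in> eigenspace V A \<theta>))"

definition multiplicity_free :: "('k, 'm) ring_scheme \<Rightarrow> ('k, 'v) module \<Rightarrow> ('v \<Rightarrow> 'v) \<Rightarrow> bool" where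
  "multiplicity_free K V A \<longleftrightarrow>
    diagonalizable K V A \<and>
    (\<forall>\<theta> \<in> eigenvalues K V A. vectorspace.dim K (V\<lparr>carrier := eigenspace V A \<theta>\<rparr>) = 1)"

definition primitive_idempotents ::
  "('k, 'm) ring_scheme \<Rightarrow> ('k, 'v) module \<Rightarrow> ('v \<Rightarrow> 'v) \<Rightarrow> ('v \<Rightarrow> 'v) set" where
  "primitive_idempotents K V A =
    {P \<in> carrier (End_alg K V). \<exists>\<theta> \<in> eigenvalues K V A.
       (\<forall>v \<in> eigenspace V A \<theta>. P v = v) \<and>
       (\<forall>\<theta>' \<in> eigenvalues K V A - {\<theta>}. \<forall>v \<in> eigenspace V A \<theta>'. P v = \<zero>\<^bsub>V\<^esub>)}"

text \<open>
  Sequences indexed by \<open>0, \<dots>, d\<close> are extensional functions on \<open>{..d}\<close>.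
\<close>

definition idempotent_ordering ::
  "('k, 'm) ring_scheme \<Rightarrow> nat \<Rightarrow> ('k, 'v) module \<Rightarrow> ('v \<Rightarrow> 'v) \<Rightarrow> (nat \<Rightarrow> 'v \<Rightarrow> 'v) \<Rightarrow> bool" where
  "idempotent_ordering K d V A E \<longleftrightarrow>
    E \<in> extensional {..d} \<and> bij_betw E {..d} (primitive_idempotents K V A)"

text \<open>A system \<open>(V, A, E, A\<^sup>*, E\<^sup>*)\<close> records its underlying vector space.\<close>

type_synonym ('k, 'v) th_system =
  "('k, 'v) module \<times> ('v \<Rightarrow> 'v) \<times> (nat \<Rightarrow> 'v \<Rightarrow> 'v) \<times> ('v \<Rightarrow> 'v) \<times> (nat \<Rightarrow> 'v \<Rightarrow> 'v)"

definition is_TH_system ::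
  "('k, 'm) ring_scheme \<Rightarrow> nat \<Rightarrow> ('k, 'v) module \<Rightarrow>
    ('v \<Rightarrow> 'v) \<Rightarrow> (nat \<Rightarrow> 'v \<Rightarrow> 'v) \<Rightarrow> ('v \<Rightarrow> 'v) \<Rightarrow> (nat \<Rightarrow> 'v \<Rightarrow> 'v) \<Rightarrow> bool" where
  "is_TH_system K d V A E As Es \<longleftrightarrow>
    vectorspace K V \<and> vectorspace.fin_dim K V \<and> vectorspace.dim K V = d + 1 \<and>
    A \<in> carrier (End_alg K V) \<and> As \<in> carrier (End_alg K V) \<and>
    multiplicity_free K V A \<and> multiplicity_free K V As \<and>
    idempotent_ordering K d V A E \<and> idempotent_ordering K d V As Es \<and>
    (\<forall>i \<le> d. \<forall>j \<le> d.
      (i > j + 1 \<longrightarrow>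
        E i \<otimes>\<^bsub>End_alg K V\<^esub> As \<otimes>\<^bsub>End_alg K V\<^esub> E j = \<zero>\<^bsub>End_alg K V\<^esub> \<and>
        Es i \<otimes>\<^bsub>End_alg K V\<^esub> A \<otimes>\<^bsub>End_alg K V\<^esub> Es j = \<zero>\<^bsub>End_alg K V\<^esub>) \<and>
      (i = j + 1 \<longrightarrow>
        E i \<otimes>\<^bsub>End_alg K V\<^esub> As \<otimes>\<^bsub>End_alg K V\<^esub> E j \<noteq> \<zero>\<^bsub>End_alg K V\<^esub> \<and>
        Es i \<otimes>\<^bsub>End_alg K V\<^esub> A \<otimes>\<^bsub>End_alg K V\<^esub> Es j \<noteq> \<zero>\<^bsub>End_alg K V\<^esub>))"

definition TH_systems :: "('k, 'm) ring_scheme \<Rightarrow> nat \<Rightarrow> ('k, 'v) th_system set" where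
  "TH_systems K d = {(V, A, E, As, Es). is_TH_system K d V A E As Es}"

definition TH_isomorphic ::
  "('k, 'm) ring_scheme \<Rightarrow> nat \<Rightarrow> ('k, 'v) th_system \<Rightarrow> ('k, 'w) th_system \<Rightarrow> bool" where
  "TH_isomorphic K d = (\<lambda>(V, A, E, As, Es) (W, B, F, Bs, Fs).
    \<exists>\<gamma> \<in> End_alg_iso K V W. B = \<gamma> A \<and> Bs = \<gamma> As \<and> (\<forall>i \<le> d. F i = \<gamma> (E i) \<and> Fs i = \<gamma> (Es i)))"

definition affine_map :: "('k, 'm) ring_scheme \<Rightarrow> ('k, 'v) module \<Rightarrow> 'k \<Rightarrow> 'k \<Rightarrow> ('v \<Rightarrow> 'v) \<Rightarrow> ('v \<Rightarrow> 'v)" where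
  "affine_map K V \<alpha> \<beta> A =
    (\<alpha> \<odot>\<^bsub>End_alg K V\<^esub> A) \<oplus>\<^bsub>End_alg K V\<^esub> (\<beta> \<odot>\<^bsub>End_alg K V\<^esub> \<one>\<^bsub>End_alg K V\<^esub>)"

definition affine_transformations ::
  "('k, 'm) ring_scheme \<Rightarrow> nat \<Rightarrow> ('k, 'v) th_system \<Rightarrow> ('k, 'v) th_system set" where
  "affine_transformations K d = (\<lambda>(V, A, E, As, Es).
    {(V, affine_map K V \<alpha> \<beta> A, E, affine_map K V \<alpha>s \<beta>s As, Es) | \<alpha> \<beta> \<alpha>s \<beta>s.
       \<alpha> \<in> carrier K - {\<zero>\<^bsub>K\<^esub>} \<and> \<beta> \<in> carrier K \<and> \<alpha>s \<in> carrier K - {\<zero>\<^bsub>K\<^esub>} \<and> \<beta>s \<in> carrier K}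
    \<inter> TH_systems K d)"

definition affine_iso_rel :: "('k, 'm) ring_scheme \<Rightarrow> nat \<Rightarrow> ('k, 'v) th_system rel" where
  "affine_iso_rel K d =
    {(\<Phi>, \<Phi>'). \<Phi> \<in> TH_systems K d \<and> \<Phi>' \<in> TH_systems K d \<and>
      (\<exists>\<Psi> \<in> affine_transformations K d \<Phi>'. TH_isomorphic K d \<Phi> \<Psi>)}"

type_synonym ('k, 'v) rth_system =
  "('k, 'v) module \<times> (nat \<Rightarrow> 'v \<Rightarrow> 'v) \<times> (nat \<Rightarrow> 'v \<Rightarrow> 'v)"

definition RTH_systems :: "('k, 'm) ring_scheme \<Rightarrow> nat \<Rightarrow> ('k, 'v) rth_system set" where
  "RTH_systems K d = {(V, E, Es). \<exists>A As. is_TH_system K d V A E As Es}"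

definition reduction :: "('k, 'v) th_system \<Rightarrow> ('k, 'v) rth_system" where
  "reduction = (\<lambda>(V, A, E, As, Es). (V, E, Es))"

definition RTH_isomorphic ::
  "('k, 'm) ring_scheme \<Rightarrow> nat \<Rightarrow> ('k, 'v) rth_system \<Rightarrow> ('k, 'w) rth_system \<Rightarrow> bool" where
  "RTH_isomorphic K d = (\<lambda>(V, E, Es) (W, F, Fs).
    \<exists>\<gamma> \<in> End_alg_iso K V W. \<forall>i \<le> d. F i = \<gamma> (E i) \<and> Fs i = \<gamma> (Es i))"

definition RTH_iso_rel :: "('k, 'm) ring_scheme \<Rightarrow> nat \<Rightarrow> ('k, 'v) rth_system rel" where
  "RTH_iso_rel K d =
    {(\<Theta>, \<Theta>'). \<Theta> \<in> RTH_systems K d \<and> \<Theta>' \<in> RTH_systems K d \<and> RTH_isomorphic K d \<Theta> \<Theta>'}"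

end

theory Submission
  imports Defs
begin

text \<open>
  Everything rests on one fact: two TH systems with isomorphic reductions are affine isomorphic. Once
  this is known (\<open>affine_iso_rel_iff_reductions\<close>), affine isomorphism is the pullback of isomorphism of
  RTH systems along the reduction map, which is onto by the definition of an RTH system, and a
  surjection induces a bijection between the classes of the pullback and those of the given relation.

  For the fact itself, let \<open>\<gamma>\<close> be an algebra isomorphism that carries the idempotents of
  \<open>(A, E, As, Es)\<close> to those of \<open>(B, F, Bs, Fs)\<close>, and compare \<open>C = \<gamma> A\<close> with \<open>B\<close>. Both are diagonal with
  respect to the \<open>F i\<close>, hence they commute; and both are upper Hessenberg with respect to the \<open>Fs i\<close>,
  with nonzero subdiagonal. Let \<open>w\<^sub>0, \<dots>, w\<^sub>d\<close> be a basis with \<open>w\<^sub>i\<close> in the range of \<open>Fs i\<close>. By the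
  Hessenberg shape, \<open>B w\<^sub>0\<close> and \<open>C w\<^sub>0\<close> lie in the span of \<open>w\<^sub>0\<close> and \<open>w\<^sub>1\<close>, and their \<open>w\<^sub>1\<close>-coefficients
  are nonzero, so that \<open>C w\<^sub>0 = \<alpha> B w\<^sub>0 + \<beta> w\<^sub>0\<close> for some \<open>\<alpha> \<noteq> 0\<close> and \<open>\<beta>\<close>. The subspace on which \<open>C\<close> and
  \<open>\<alpha> B + \<beta> I\<close> agree is invariant under \<open>B\<close>, as \<open>B\<close> and \<open>C\<close> commute, and it contains \<open>w\<^sub>0\<close>. But \<open>w\<^sub>0\<close>
  is a cyclic vector of \<open>B\<close>, because \<open>B w\<^sub>k\<close> is a nonzero multiple of \<open>w\<^bsub>k+1\<^esub>\<close> modulo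
  \<open>w\<^sub>0, \<dots>, w\<^sub>k\<close>; hence \<open>C = \<alpha> B + \<beta> I\<close> everywhere (\<open>commuting_hessenberg_affine\<close>). Interchanging the
  roles of \<open>A\<close> and \<open>As\<close> gives the same for \<open>\<gamma> As\<close> and \<open>Bs\<close>.

  It remains to see that replacing \<open>B\<close> and \<open>Bs\<close> by such affine images again gives a TH system
  (\<open>is_TH_system_affine\<close>): the eigenspaces are the same, the eigenvalues are moved by an injective
  map, and the off-diagonal products are multiplied by \<open>\<alpha>\<close>.
\<close>

section \<open>The algebra of extensional endomorphisms\<close>

lemma End_alg_simps:
  "carrier (End_alg K V) = module_hom K V V \<inter> extensional (carrier V)"
  "S \<otimes>\<^bsub>End_alg K V\<^esub> T = compose (carrier V) S T"
  "\<one>\<^bsub>End_alg K V\<^esub> = (\<lambda>v \<in> carrier V. v)"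
  "\<zero>\<^bsub>End_alg K V\<^esub> = (\<lambda>v \<in> carrier V. \<zero>\<^bsub>V\<^esub>)"
  "S \<oplus>\<^bsub>End_alg K V\<^esub> T = (\<lambda>v \<in> carrier V. S v \<oplus>\<^bsub>V\<^esub> T v)"
  "c \<odot>\<^bsub>End_alg K V\<^esub> T = (\<lambda>v \<in> carrier V. c \<odot>\<^bsub>V\<^esub> T v)"
  by (simp_all add: End_alg_def)

lemma End_alg_homD: "T \<in> carrier (End_alg K V) \<Longrightarrow> T \<in> module_hom K V V"
  by (simp add: End_alg_simps)

lemma End_alg_closed: "T \<in> carrier (End_alg K V) \<Longrightarrow> v \<in> carrier V \<Longrightarrow> T v \<in> carrier V"
  by (auto simp: End_alg_simps module_hom_def)

lemma End_alg_eqI: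
  assumes "S \<in> carrier (End_alg K V)" "T \<in> carrier (End_alg K V)"
    and "\<And>v. v \<in> carrier V \<Longrightarrow> S v = T v"
  shows "S = T"
  using assms by (auto simp: End_alg_simps intro: extensionalityI)

lemma hom_closed: "T \<in> module_hom K V W \<Longrightarrow> v \<in> carrier V \<Longrightarrow> T v \<in> carrier W"
  by (auto simp: module_hom_def)

context vectorspace
begin

lemma hom_zero:
  assumes "T \<in> module_hom K V V"
  shows "T \<zero>\<^bsub>V\<^esub> = \<zero>\<^bsub>V\<^esub>"
proof -
  interpret mod_hom K V V T
    using assms by unfold_locales
  show ?thesis by simp
qed

lemma smult_eq_zeroD:
  assumes "a \<in> carrier K" "v \<in> carrier V" "a \<odot>\<^bsub>V\<^esub> v = \<zero>\<^bsub>V\<^esub>"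
  shows "a = \<zero>\<^bsub>K\<^esub> \<or> v = \<zero>\<^bsub>V\<^esub>"
  using mult_inverse[OF assms] assms(1)
  by (metis field_Units Units_inv_closed Diff_iff singletonD smult_r_null)

lemma add_add_exchange:
  assumes "a \<in> carrier V" "b \<in> carrier V" "c \<in> carrier V" "e \<in> carrier V"
  shows "(a \<oplus>\<^bsub>V\<^esub> b) \<oplus>\<^bsub>V\<^esub> (c \<oplus>\<^bsub>V\<^esub> e) = (a \<oplus>\<^bsub>V\<^esub> c) \<oplus>\<^bsub>V\<^esub> (b \<oplus>\<^bsub>V\<^esub> e)"
  using assms by (simp add: M.a_ac)

lemma submoduleI:
  assumes "N \<subseteq> carrier V" "\<zero>\<^bsub>V\<^esub> \<in> N"
    and "\<And>x y. x \<in> N \<Longrightarrow> y \<in> N \<Longrightarrow> x \<oplus>\<^bsub>V\<^esub> y \<in> N"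
    and "\<And>c x. c \<in> carrier K \<Longrightarrow> x \<in> N \<Longrightarrow> c \<odot>\<^bsub>V\<^esub> x \<in> N"
  shows "submodule K N V"
  using assms module_axioms by (intro submodule.intro) auto

lemma equalizer_submodule:
  assumes S: "S \<in> module_hom K V V" and T: "T \<in> module_hom K V V"
  shows "submodule K {x \<in> carrier V. S x = T x} V"
  using S T by (intro submoduleI) (auto simp: hom_zero module_hom_add module_hom_smult)

lemma hom_eq_on_span:
  assumes "S \<in> module_hom K V V" "T \<in> module_hom K V V"
    and "X \<subseteq> carrier V" "\<And>x. x \<in> X \<Longrightarrow> S x = T x" "v \<in> span X"
  shows "S v = T v"
proof -
  have "span X \<subseteq> {x \<in> carrier V. S x = T x}"
    using assms by (intro span_is_subset equalizer_submodule) auto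
  then show ?thesis using assms(5) by auto
qed

end

context
  fixes K :: "('k, 'm) ring_scheme" and V :: "('k, 'v) module"
  assumes vs: "vectorspace K V"
begin

interpretation vectorspace K V by (rule vs)

lemma End_algI:
  assumes "T \<in> extensional (carrier V)"
    and "\<And>x. x \<in> carrier V \<Longrightarrow> T x \<in> carrier V"
    and "\<And>x y. x \<in> carrier V \<Longrightarrow> y \<in> carrier V \<Longrightarrow> T (x \<oplus>\<^bsub>V\<^esub> y) = T x \<oplus>\<^bsub>V\<^esub> T y"
    and "\<And>c x. c \<in> carrier K \<Longrightarrow> x \<in> carrier V \<Longrightarrow> T (c \<odot>\<^bsub>V\<^esub> x) = c \<odot>\<^bsub>V\<^esub> T x"
  shows "T \<in> carrier (End_alg K V)"
  using assms by (auto simp: End_alg_simps module_hom_def)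

lemma End_add:
  assumes "T \<in> carrier (End_alg K V)" "x \<in> carrier V" "y \<in> carrier V"
  shows "T (x \<oplus>\<^bsub>V\<^esub> y) = T x \<oplus>\<^bsub>V\<^esub> T y"
  using assms by (auto simp: End_alg_simps module_hom_def)

lemma End_smult:
  assumes "T \<in> carrier (End_alg K V)" "c \<in> carrier K" "x \<in> carrier V"
  shows "T (c \<odot>\<^bsub>V\<^esub> x) = c \<odot>\<^bsub>V\<^esub> T x"
  using assms by (auto simp: End_alg_simps module_hom_def)

lemma End_mult_closed:
  assumes "S \<in> carrier (End_alg K V)" "T \<in> carrier (End_alg K V)"
  shows "S \<otimes>\<^bsub>End_alg K V\<^esub> T \<in> carrier (End_alg K V)"
  by (rule End_algI)
    (simp_all add: End_alg_simps(2) compose_def End_alg_closed[OF assms(1)] End_alg_closed[OF assms(2)]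
      End_add[OF assms(1)] End_add[OF assms(2)] End_smult[OF assms(1)] End_smult[OF assms(2)])

lemma End_one_closed: "\<one>\<^bsub>End_alg K V\<^esub> \<in> carrier (End_alg K V)"
  by (rule End_algI) (simp_all add: End_alg_simps(3))

lemma End_zero_closed: "\<zero>\<^bsub>End_alg K V\<^esub> \<in> carrier (End_alg K V)"
  by (rule End_algI) (simp_all add: End_alg_simps(4))

lemma End_add_closed:
  assumes "S \<in> carrier (End_alg K V)" "T \<in> carrier (End_alg K V)"
  shows "S \<oplus>\<^bsub>End_alg K V\<^esub> T \<in> carrier (End_alg K V)"
proof (rule End_algI)
  fix x y assume xy: "x \<in> carrier V" "y \<in> carrier V"
  have "(S x \<oplus>\<^bsub>V\<^esub> S y) \<oplus>\<^bsub>V\<^esub> (T x \<oplus>\<^bsub>V\<^esub> T y) = (S x \<oplus>\<^bsub>V\<^esub> T x) \<oplus>\<^bsub>V\<^esub> (S y \<oplus>\<^bsub>V\<^esub> T y)"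
    using xy End_alg_closed[OF assms(1)] End_alg_closed[OF assms(2)] by (intro add_add_exchange) auto
  then show "(S \<oplus>\<^bsub>End_alg K V\<^esub> T) (x \<oplus>\<^bsub>V\<^esub> y) = (S \<oplus>\<^bsub>End_alg K V\<^esub> T) x \<oplus>\<^bsub>V\<^esub> (S \<oplus>\<^bsub>End_alg K V\<^esub> T) y"
    using xy by (simp add: End_alg_simps(5) End_add[OF assms(1)] End_add[OF assms(2)])
qed (simp_all add: End_alg_simps(5) End_alg_closed[OF assms(1)] End_alg_closed[OF assms(2)]
      End_smult[OF assms(1)] End_smult[OF assms(2)] smult_r_distr)

lemma End_smult_closed:
  assumes "c \<in> carrier K" "T \<in> carrier (End_alg K V)"
  shows "c \<odot>\<^bsub>End_alg K V\<^esub> T \<in> carrier (End_alg K V)"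
proof (rule End_algI)
  fix a x assume "a \<in> carrier K" "x \<in> carrier V"
  then show "(c \<odot>\<^bsub>End_alg K V\<^esub> T) (a \<odot>\<^bsub>V\<^esub> x) = a \<odot>\<^bsub>V\<^esub> (c \<odot>\<^bsub>End_alg K V\<^esub> T) x"
    using assms(1) smult_assoc1[of c a "T x"] smult_assoc1[of a c "T x"] m_comm[of c a]
    by (simp add: End_alg_simps(6) End_smult[OF assms(2)] End_alg_closed[OF assms(2)])
qed (simp_all add: End_alg_simps(6) End_alg_closed[OF assms(2)] assms(1)
      End_add[OF assms(2)] smult_r_distr)

end

section \<open>Bases adapted to a system of idempotents\<close>

text \<open>
  The vectors \<open>u i\<close> form a basis and \<open>E i\<close> is the projection to the line of \<open>u i\<close>. A map
  with eigenvectors \<open>u i\<close> is kept out of the locale, because the basis attached to \<open>Es\<close> also serves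
  for maps that are not diagonal in it.
\<close>

locale idempotent_frame = vectorspace K V
  for K :: "('k, 'm) ring_scheme" and V :: "('k, 'v) module" +
  fixes d :: nat and u :: "nat \<Rightarrow> 'v" and E :: "nat \<Rightarrow> 'v \<Rightarrow> 'v"
  assumes frame_carrier: "i \<le> d \<Longrightarrow> u i \<in> carrier V"
    and frame_nonzero: "i \<le> d \<Longrightarrow> u i \<noteq> \<zero>\<^bsub>V\<^esub>"
    and proj_hom: "i \<le> d \<Longrightarrow> E i \<in> module_hom K V V"
    and proj_frame: "i \<le> d \<Longrightarrow> j \<le> d \<Longrightarrow> E i (u j) = (if i = j then u j else \<zero>\<^bsub>V\<^esub>)"
    and frame_span: "span (u ` {..d}) = carrier V"
begin

lemma proj_closed: "i \<le> d \<Longrightarrow> x \<in> carrier V \<Longrightarrow> E i x \<in> carrier V"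
  using proj_hom hom_closed by metis

lemma frame_induct:
  assumes "submodule K N V" "\<And>i. i \<le> d \<Longrightarrow> u i \<in> N" "x \<in> carrier V"
  shows "x \<in> N"
proof -
  have "u ` {..d} \<subseteq> N" using assms(2) by blast
  from span_is_subset[OF this assms(1)] assms(3) show ?thesis
    unfolding frame_span by (rule subsetD)
qed

lemma hom_eq_on_frame:
  assumes "S \<in> module_hom K V V" "T \<in> module_hom K V V"
    and "\<And>i. i \<le> d \<Longrightarrow> S (u i) = T (u i)" "x \<in> carrier V"
  shows "S x = T x"
proof (rule hom_eq_on_span[OF assms(1,2)])
  show "u ` {..d} \<subseteq> carrier V" using frame_carrier by blast
  show "x \<in> span (u ` {..d})" unfolding frame_span by (rule assms(4))
qed (use assms(3) in blast)

text \<open>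
The scalar is the coordinate of \<open>x\<close> at \<open>u i\<close>; the rank-one form of \<open>E i\<close> stands in for
expansions in the basis.
\<close>

lemma proj_scalar:
  assumes i: "i \<le> d" and x: "x \<in> carrier V"
  shows "\<exists>c \<in> carrier K. E i x = c \<odot>\<^bsub>V\<^esub> u i"
proof -
  let ?N = "{x \<in> carrier V. \<exists>c \<in> carrier K. E i x = c \<odot>\<^bsub>V\<^esub> u i}"
  have "submodule K ?N V"
  proof (rule submoduleI)
    have "E i \<zero>\<^bsub>V\<^esub> = \<zero>\<^bsub>K\<^esub> \<odot>\<^bsub>V\<^esub> u i"
      using hom_zero[OF proj_hom[OF i]] frame_carrier[OF i] by simp
    then show "\<zero>\<^bsub>V\<^esub> \<in> ?N" by blast
    show "x \<oplus>\<^bsub>V\<^esub> y \<in> ?N" if xy: "x \<in> ?N" "y \<in> ?N" for x y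
    proof -
      from xy obtain a b where ab: "a \<in> carrier K" "b \<in> carrier K"
        and "E i x = a \<odot>\<^bsub>V\<^esub> u i" "E i y = b \<odot>\<^bsub>V\<^esub> u i" by blast
      then have "E i (x \<oplus>\<^bsub>V\<^esub> y) = (a \<oplus>\<^bsub>K\<^esub> b) \<odot>\<^bsub>V\<^esub> u i"
        using xy smult_l_distr[OF ab frame_carrier[OF i]] module_hom_add[OF proj_hom[OF i]] by simp
      then show ?thesis using xy ab by blast
    qed
    show "c \<odot>\<^bsub>V\<^esub> x \<in> ?N" if c: "c \<in> carrier K" and x: "x \<in> ?N" for c x
    proof -
      from x obtain a where a: "a \<in> carrier K" and "E i x = a \<odot>\<^bsub>V\<^esub> u i" by blast
      then have "E i (c \<odot>\<^bsub>V\<^esub> x) = (c \<otimes>\<^bsub>K\<^esub> a) \<odot>\<^bsub>V\<^esub> u i"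
        using x c smult_assoc1[OF c a frame_carrier[OF i]] module_hom_smult[OF proj_hom[OF i] c] by simp
      then show ?thesis using x c a by blast
    qed
  qed auto
  moreover have "u j \<in> ?N" if j: "j \<le> d" for j
  proof -
    have "E i (u j) = (if i = j then \<one>\<^bsub>K\<^esub> else \<zero>\<^bsub>K\<^esub>) \<odot>\<^bsub>V\<^esub> u i"
      using proj_frame[OF i j] frame_carrier[OF i] frame_carrier[OF j] by simp
    moreover have "(if i = j then \<one>\<^bsub>K\<^esub> else \<zero>\<^bsub>K\<^esub>) \<in> carrier K" by simp
    ultimately show ?thesis using frame_carrier[OF j] by blast
  qed
  ultimately show ?thesis
    using frame_induct[of ?N x] x by blast
qed

lemma resolution_of_identity:
  assumes x: "x \<in> carrier V"
  shows "(\<Oplus>\<^bsub>V\<^esub>i\<in>{..d}. E i x) = x"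
proof -
  let ?N = "{x \<in> carrier V. (\<Oplus>\<^bsub>V\<^esub>i\<in>{..d}. E i x) = x}"
  have "submodule K ?N V"
  proof (rule submoduleI)
    show "\<zero>\<^bsub>V\<^esub> \<in> ?N"
      using hom_zero[OF proj_hom] by (auto intro!: finsum_all0)
    show "x \<oplus>\<^bsub>V\<^esub> y \<in> ?N" if "x \<in> ?N" "y \<in> ?N" for x y
    proof -
      have "(\<Oplus>\<^bsub>V\<^esub>i\<in>{..d}. E i (x \<oplus>\<^bsub>V\<^esub> y)) = (\<Oplus>\<^bsub>V\<^esub>i\<in>{..d}. E i x \<oplus>\<^bsub>V\<^esub> E i y)"
        using that proj_closed by (intro finsum_cong') (auto simp: module_hom_add[OF proj_hom])
      also have "\<dots> = x \<oplus>\<^bsub>V\<^esub> y"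
        using that proj_closed by (subst finsum_addf) auto
      finally show ?thesis using that by auto
    qed
    show "c \<odot>\<^bsub>V\<^esub> x \<in> ?N" if "c \<in> carrier K" "x \<in> ?N" for c x
    proof -
      have "(\<Oplus>\<^bsub>V\<^esub>i\<in>{..d}. E i (c \<odot>\<^bsub>V\<^esub> x)) = (\<Oplus>\<^bsub>V\<^esub>i\<in>{..d}. c \<odot>\<^bsub>V\<^esub> E i x)"
        using that proj_closed by (intro finsum_cong') (auto simp: module_hom_smult[OF proj_hom])
      also have "\<dots> = c \<odot>\<^bsub>V\<^esub> x"
        using that proj_closed by (subst finsum_smult[symmetric]) auto
      finally show ?thesis using that by auto
    qed
  qed auto
  moreover have "u j \<in> ?N" if "j \<le> d" for j
  proof -
    have "(\<Oplus>\<^bsub>V\<^esub>i\<in>{..d}. E i (u j)) = (\<Oplus>\<^bsub>V\<^esub>i\<in>{..d}. if j = i then u i else \<zero>\<^bsub>V\<^esub>)"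
      using that frame_carrier proj_frame by (intro finsum_cong') auto
    also have "\<dots> = u j"
      using that frame_carrier by (intro finsum_singleton) auto
    finally show ?thesis using that frame_carrier by auto
  qed
  ultimately show ?thesis
    using frame_induct[of ?N x] x by blast
qed

lemma eq_if_projs_eq:
  assumes "x \<in> carrier V" "y \<in> carrier V" "\<And>i. i \<le> d \<Longrightarrow> E i x = E i y"
  shows "x = y"
proof -
  have "(\<Oplus>\<^bsub>V\<^esub>i\<in>{..d}. E i x) = (\<Oplus>\<^bsub>V\<^esub>i\<in>{..d}. E i y)"
    using assms proj_closed by (intro finsum_cong') auto
  then show ?thesis using resolution_of_identity[OF assms(1)] resolution_of_identity[OF assms(2)] by simp
qed

lemma proj_proj:
  assumes "i \<le> d" "j \<le> d" "x \<in> carrier V"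
  shows "E i (E j x) = (if i = j then E j x else \<zero>\<^bsub>V\<^esub>)"
proof -
  obtain c where c: "c \<in> carrier K" "E j x = c \<odot>\<^bsub>V\<^esub> u j"
    using proj_scalar[OF assms(2,3)] by blast
  then have "E i (E j x) = c \<odot>\<^bsub>V\<^esub> E i (u j)"
    using module_hom_smult[OF proj_hom[OF assms(1)] c(1) frame_carrier[OF assms(2)]] by simp
  then show ?thesis
    using c proj_frame[OF assms(1,2)] by simp
qed

end

text \<open>
  The proof is a count, starting from the \<open>d + 1\<close> primitive idempotents that \<open>E\<close> lists rather than
  from the eigenspaces. A primitive idempotent is determined by its eigenvalue, since the
  eigenvectors span, so the \<open>d + 1\<close> eigenvalues that belong to the \<open>E i\<close> are distinct. Choosing an
  eigenvector for each of them gives \<open>d + 1\<close> vectors which the \<open>E i\<close> separate; they are linearly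
  independent, and a basis for dimension reasons.
\<close>

lemma idempotent_frame_exists:
  fixes K :: "('k, 'm) ring_scheme" and V :: "('k, 'v) module"
  assumes vs: "vectorspace K V" and fd: "vectorspace.fin_dim K V"
    and dim: "vectorspace.dim K V = d + 1"
    and diag: "diagonalizable K V A" and ord: "idempotent_ordering K d V A E"
  shows "\<exists>u \<theta>. idempotent_frame K V d u E \<and>
    (\<forall>i \<le> d. \<theta> i \<in> carrier K \<and> A (u i) = \<theta> i \<odot>\<^bsub>V\<^esub> u i)"
proof -
  interpret vectorspace K V by (rule vs)
  have prim: "E i \<in> primitive_idempotents K V A" if "i \<le> d" for i
    using ord that unfolding idempotent_ordering_def by (auto dest: bij_betwE)
  have E_End: "E i \<in> carrier (End_alg K V)" if "i \<le> d" for i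
    using prim[OF that] unfolding primitive_idempotents_def by blast
  note E_hom = End_alg_homD[OF E_End]
  have "\<forall>i \<in> {..d}. \<exists>t. t \<in> eigenvalues K V A \<and> (\<forall>v \<in> eigenspace V A t. E i v = v) \<and>
      (\<forall>t' \<in> eigenvalues K V A - {t}. \<forall>v \<in> eigenspace V A t'. E i v = \<zero>\<^bsub>V\<^esub>)"
    using prim unfolding primitive_idempotents_def by blast
  from bchoice[OF this] obtain \<theta> where choice: "\<forall>i \<in> {..d}. \<theta> i \<in> eigenvalues K V A \<and>
      (\<forall>v \<in> eigenspace V A (\<theta> i). E i v = v) \<and>
      (\<forall>t' \<in> eigenvalues K V A - {\<theta> i}. \<forall>v \<in> eigenspace V A t'. E i v = \<zero>\<^bsub>V\<^esub>)"
    by blast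
  have \<theta>: "\<theta> i \<in> eigenvalues K V A" if "i \<le> d" for i
    using choice that by blast
  have fix_E: "E i v = v" if "i \<le> d" "v \<in> eigenspace V A (\<theta> i)" for i v
    using choice that by blast
  have kill_E: "E i v = \<zero>\<^bsub>V\<^esub>"
    if "i \<le> d" "t \<in> eigenvalues K V A" "t \<noteq> \<theta> i" "v \<in> eigenspace V A t" for i t v
    using choice that by blast
  have "\<forall>i \<in> {..d}. \<exists>v. v \<in> eigenspace V A (\<theta> i) \<and> v \<noteq> \<zero>\<^bsub>V\<^esub>"
    using \<theta> unfolding eigenvalues_def by blast
  from bchoice[OF this] obtain u
    where u_choice: "\<forall>i \<in> {..d}. u i \<in> eigenspace V A (\<theta> i) \<and> u i \<noteq> \<zero>\<^bsub>V\<^esub>" by blast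
  have u: "u i \<in> eigenspace V A (\<theta> i)" and u_nz: "u i \<noteq> \<zero>\<^bsub>V\<^esub>" if "i \<le> d" for i
    using u_choice that by blast+
  have u_V: "u i \<in> carrier V" and A_u: "A (u i) = \<theta> i \<odot>\<^bsub>V\<^esub> u i" and \<theta>_K: "\<theta> i \<in> carrier K"
    if "i \<le> d" for i
    using u[OF that] \<theta>[OF that] unfolding eigenspace_def eigenvalues_def by blast+
  obtain B where B: "basis B" "\<And>v. v \<in> B \<Longrightarrow> \<exists>t \<in> carrier K. v \<in> eigenspace V A t"
    using diag unfolding diagonalizable_def by blast
  have \<theta>_inj: "i = j" if i: "i \<le> d" and j: "j \<le> d" and eq: "\<theta> i = \<theta> j" for i j
  proof -
    have "E i v = E j v" if v: "v \<in> B" for v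
    proof (cases "v = \<zero>\<^bsub>V\<^esub>")
      case True
      then show ?thesis using hom_zero[OF E_hom[OF i]] hom_zero[OF E_hom[OF j]] by simp
    next
      case False
      obtain t where t: "t \<in> carrier K" "v \<in> eigenspace V A t" using B(2)[OF v] by blast
      then have t': "t \<in> eigenvalues K V A" using False unfolding eigenvalues_def by blast
      show ?thesis
      proof (cases "t = \<theta> i")
        case True
        then show ?thesis using fix_E[OF i] fix_E[OF j] t(2) eq by simp
      next
        case False
        then show ?thesis using kill_E[OF i t' _ t(2)] kill_E[OF j t' _ t(2)] eq by simp
      qed
    qed
    then have "E i v = E j v" if "v \<in> carrier V" for v
      using hom_eq_on_span[OF E_hom[OF i] E_hom[OF j], of B v] B(1) that unfolding basis_def by blast
    then have "E i = E j" by (rule End_alg_eqI[OF E_End[OF i] E_End[OF j]])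
    then show ?thesis
      using ord i j unfolding idempotent_ordering_def bij_betw_def by (auto dest: inj_onD)
  qed
  have E_u: "E i (u j) = (if i = j then u j else \<zero>\<^bsub>V\<^esub>)" if i: "i \<le> d" and j: "j \<le> d" for i j
  proof (cases "i = j")
    case True
    then show ?thesis using fix_E[OF i] u[OF i] by simp
  next
    case False
    then have "\<theta> j \<noteq> \<theta> i" using \<theta>_inj[OF i j] by auto
    then show ?thesis using False kill_E[OF i \<theta>[OF j] _ u[OF j]] by simp
  qed
  let ?U = "u ` {..d}"
  have U_V: "?U \<subseteq> carrier V" using u_V by blast
  have inj: "inj_on u {..d}"
  proof (rule inj_onI)
    fix i j assume "i \<in> {..d}" "j \<in> {..d}" and eq: "u i = u j"
    then have i: "i \<le> d" and j: "j \<le> d" by auto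
    show "i = j" using E_u[OF i i] E_u[OF i j] eq u_nz[OF i] by (metis (full_types))
  qed
  have li: "lin_indpt ?U"
  proof
    assume "lin_dep ?U"
    then obtain S a v where S: "finite S" "S \<subseteq> ?U" "a \<in> S \<rightarrow> carrier K" "lincomb a S = \<zero>\<^bsub>V\<^esub>"
      and v: "v \<in> S" "a v \<noteq> \<zero>\<^bsub>K\<^esub>"
      unfolding lin_dep_def by blast
    obtain i where i: "i \<le> d" "v = u i" using S(2) v(1) by auto
    let ?r = "lincomb a (S - {v})"
    have av: "a v \<in> carrier K" using S(3) v(1) by blast
    have r_V: "?r \<in> carrier V" using S U_V by (intro lincomb_closed) auto
    have "E i x = \<zero>\<^bsub>End_alg K V\<^esub> x" if "x \<in> S - {v}" for x
    proof -
      obtain j where j: "j \<le> d" "x = u j" using S(2) \<open>x \<in> S - {v}\<close> by auto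
      then have "i \<noteq> j" using \<open>x \<in> S - {v}\<close> i(2) by auto
      then show ?thesis using E_u[OF i(1) j(1)] j u_V[OF j(1)] by (simp add: End_alg_simps(4))
    qed
    moreover have "?r \<in> span (S - {v})"
      using S unfolding span_def by auto
    moreover have "S - {v} \<subseteq> carrier V" using S(2) U_V by blast
    ultimately have "E i ?r = \<zero>\<^bsub>End_alg K V\<^esub> ?r"
      using hom_eq_on_span[OF E_hom[OF i(1)] End_alg_homD[OF End_zero_closed[OF vs]]] by blast
    then have E_r: "E i ?r = \<zero>\<^bsub>V\<^esub>" using r_V by (simp add: End_alg_simps(4))
    have "(a v \<odot>\<^bsub>V\<^esub> v) \<oplus>\<^bsub>V\<^esub> ?r = \<zero>\<^bsub>V\<^esub>"
      using lincomb_del2[of S a v] S v(1) U_V by auto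
    then have "E i ((a v \<odot>\<^bsub>V\<^esub> v) \<oplus>\<^bsub>V\<^esub> ?r) = \<zero>\<^bsub>V\<^esub>"
      using hom_zero[OF E_hom[OF i(1)]] by simp
    then have "a v \<odot>\<^bsub>V\<^esub> u i = \<zero>\<^bsub>V\<^esub>"
      using E_r av r_V i u_V[OF i(1)] E_u[OF i(1) i(1)]
        module_hom_add[OF E_hom[OF i(1)]] module_hom_smult[OF E_hom[OF i(1)]] by simp
    then show False using smult_eq_zeroD[OF av u_V[OF i(1)]] v(2) u_nz[OF i(1)] by blast
  qed
  have "basis ?U"
    using dim_li_is_basis[OF fd _ U_V li] dim card_image[OF inj] by simp
  then have "span ?U = carrier V" unfolding basis_def by blast
  then have "idempotent_frame K V d u E"
    using u_V u_nz E_hom E_u by unfold_locales auto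
  then show ?thesis using A_u \<theta>_K by blast
qed

section \<open>Hessenberg maps and their cyclic vector\<close>

lemma affine_map_apply:
  "x \<in> carrier V \<Longrightarrow> affine_map K V \<alpha> \<beta> A x = (\<alpha> \<odot>\<^bsub>V\<^esub> A x) \<oplus>\<^bsub>V\<^esub> (\<beta> \<odot>\<^bsub>V\<^esub> x)"
  by (simp add: affine_map_def End_alg_simps)

lemma affine_map_closed:
  fixes V :: "('k, 'v) module"
  assumes "vectorspace K V" "A \<in> carrier (End_alg K V)" "\<alpha> \<in> carrier K" "\<beta> \<in> carrier K"
  shows "affine_map K V \<alpha> \<beta> A \<in> carrier (End_alg K V)"
  unfolding affine_map_def
  by (intro End_add_closed End_smult_closed End_one_closed assms)

text \<open>
In a basis adapted to the \<open>F i\<close>, the matrix of \<open>X\<close> is upper Hessenberg with no zero on the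
subdiagonal.
\<close>

definition hessenberg ::
  "('k, 'm) ring_scheme \<Rightarrow> ('k, 'v) module \<Rightarrow> nat \<Rightarrow> (nat \<Rightarrow> 'v \<Rightarrow> 'v) \<Rightarrow> ('v \<Rightarrow> 'v) \<Rightarrow> bool" where
  "hessenberg K V d F X \<longleftrightarrow>
    (\<forall>i \<le> d. \<forall>j \<le> d.
      (i > j + 1 \<longrightarrow> F i \<otimes>\<^bsub>End_alg K V\<^esub> X \<otimes>\<^bsub>End_alg K V\<^esub> F j = \<zero>\<^bsub>End_alg K V\<^esub>) \<and>
      (i = j + 1 \<longrightarrow> F i \<otimes>\<^bsub>End_alg K V\<^esub> X \<otimes>\<^bsub>End_alg K V\<^esub> F j \<noteq> \<zero>\<^bsub>End_alg K V\<^esub>))"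

lemma End_mult3_apply:
  assumes "x \<in> carrier V" "T x \<in> carrier V"
  shows "(R \<otimes>\<^bsub>End_alg K V\<^esub> S \<otimes>\<^bsub>End_alg K V\<^esub> T) x = R (S (T x))"
  using assms by (simp add: End_alg_simps(2) compose_def)

context idempotent_frame
begin

lemma hessenberg_zero:
  assumes "hessenberg K V d E X" "i \<le> d" "j + 1 < i" "x \<in> carrier V"
  shows "E i (X (E j x)) = \<zero>\<^bsub>V\<^esub>"
proof -
  have "E i \<otimes>\<^bsub>End_alg K V\<^esub> X \<otimes>\<^bsub>End_alg K V\<^esub> E j = \<zero>\<^bsub>End_alg K V\<^esub>"
    using assms(1-3) unfolding hessenberg_def by simp
  then have "(E i \<otimes>\<^bsub>End_alg K V\<^esub> X \<otimes>\<^bsub>End_alg K V\<^esub> E j) x = \<zero>\<^bsub>End_alg K V\<^esub> x" by simp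
  moreover have "E j x \<in> carrier V" using assms proj_closed[of j x] by simp
  ultimately show ?thesis
    using End_mult3_apply[where T = "E j" and x = x and V = V and K = K and R = "E i" and S = X] assms(4)
    by (simp add: End_alg_simps(4))
qed

text \<open>
As \<open>E j\<close> maps into the line of \<open>u j\<close>, a product \<open>E (j + 1) X E j\<close> that is not zero does not
vanish at \<open>u j\<close>.
\<close>

lemma hessenberg_subdiagonal:
  assumes hess: "hessenberg K V d E X" and X: "X \<in> carrier (End_alg K V)" and j: "Suc j \<le> d"
  shows "E (Suc j) (X (u j)) \<noteq> \<zero>\<^bsub>V\<^esub>"
proof
  assume zero: "E (Suc j) (X (u j)) = \<zero>\<^bsub>V\<^esub>"
  have j': "j \<le> d" using j by simp
  have "(E (Suc j) \<otimes>\<^bsub>End_alg K V\<^esub> X \<otimes>\<^bsub>End_alg K V\<^esub> E j) x = \<zero>\<^bsub>End_alg K V\<^esub> x" for x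
  proof (cases "x \<in> carrier V")
    case x: True
    obtain t where t: "t \<in> carrier K" "E j x = t \<odot>\<^bsub>V\<^esub> u j"
      using proj_scalar[OF j' x] by blast
    have "E (Suc j) (X (E j x)) = t \<odot>\<^bsub>V\<^esub> E (Suc j) (X (u j))"
      using t End_smult[OF vectorspace_axioms X t(1) frame_carrier[OF j']]
        module_hom_smult[OF proj_hom[OF j] t(1) End_alg_closed[OF X frame_carrier[OF j']]] by simp
    also have "\<dots> = \<zero>\<^bsub>V\<^esub>" using zero t(1) by simp
    finally show ?thesis
      using x End_mult3_apply[where K = K and R = "E (Suc j)" and S = X and T = "E j", OF x proj_closed[OF j' x]] by (simp add: End_alg_simps(4))
  next
    case False
    then show ?thesis by (simp add: End_alg_simps compose_def)
  qed
  then have "E (Suc j) \<otimes>\<^bsub>End_alg K V\<^esub> X \<otimes>\<^bsub>End_alg K V\<^esub> E j = \<zero>\<^bsub>End_alg K V\<^esub>" by (rule ext)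
  then show False using hess j unfolding hessenberg_def by simp
qed

text \<open>
  The first basis vector is cyclic for a Hessenberg map: \<open>A (u j)\<close> equals
  \<open>E (j + 1) (A (u j))\<close>, a nonzero multiple of \<open>u (j + 1)\<close>, plus a combination of \<open>u 0, \<dots>, u j\<close>.
  So an invariant subspace that contains \<open>u 0, \<dots>, u j\<close> contains \<open>u (j + 1)\<close> too.
\<close>

lemma frame_in_invariant_submodule:
  assumes N: "submodule K N V" and hess: "hessenberg K V d E A" and A: "A \<in> carrier (End_alg K V)"
    and inv: "\<And>x. x \<in> N \<Longrightarrow> A x \<in> N" and "u 0 \<in> N" and "k \<le> d"
  shows "u k \<in> N"
  using \<open>k \<le> d\<close>
proof (induction k rule: less_induct)
  case (less k)
  show ?case
  proof (cases k)
    case 0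
    then show ?thesis using assms(5) by simp
  next
    case (Suc j)
    have j: "j \<le> d" and k: "Suc j \<le> d" using Suc less.prems by auto
    have u_N: "u i \<in> N" if "i \<le> j" for i using less that Suc by simp
    have N_V: "N \<subseteq> carrier V" and N_zero: "\<zero>\<^bsub>V\<^esub> \<in> N"
      and N_add: "\<And>x y. x \<in> N \<Longrightarrow> y \<in> N \<Longrightarrow> x \<oplus>\<^bsub>V\<^esub> y \<in> N"
      and N_smult: "\<And>c x. c \<in> carrier K \<Longrightarrow> x \<in> N \<Longrightarrow> c \<odot>\<^bsub>V\<^esub> x \<in> N"
      using N unfolding submodule_def by auto
    let ?y = "A (u j)"
    have y_N: "?y \<in> N" using inv u_N by simp
    then have y_V: "?y \<in> carrier V" using N_V by blast
    have terms: "E i ?y \<in> N" if i: "i \<in> {..d} - {k}" for i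
    proof (cases "i \<le> j")
      case True
      obtain t where "t \<in> carrier K" "E i ?y = t \<odot>\<^bsub>V\<^esub> u i" using proj_scalar[of i ?y] y_V i by auto
      then show ?thesis using N_smult u_N[OF True] by simp
    next
      case False
      then have "E i (A (E j (u j))) = \<zero>\<^bsub>V\<^esub>"
        using i Suc frame_carrier[OF j] by (intro hessenberg_zero[OF hess]) auto
      then show ?thesis using proj_frame[OF j j] N_zero by simp
    qed
    have sum_N: "(\<Oplus>\<^bsub>V\<^esub>i\<in>S. E i ?y) \<in> N" if "finite S" "S \<subseteq> {..d} - {k}" for S
      using that
    proof (induction S)
      case empty
      then show ?case using N_zero by simp
    next
      case (insert i S)
      have "(\<lambda>i. E i ?y) \<in> S \<rightarrow> carrier V" using insert.prems terms N_V by blast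
      moreover have "E i ?y \<in> carrier V" using insert.prems terms N_V by blast
      ultimately have "(\<Oplus>\<^bsub>V\<^esub>i\<in>insert i S. E i ?y) = E i ?y \<oplus>\<^bsub>V\<^esub> (\<Oplus>\<^bsub>V\<^esub>i\<in>S. E i ?y)"
        using insert.hyps by (intro finsum_insert) auto
      then show ?case using insert terms N_add by simp
    qed
    let ?R = "\<Oplus>\<^bsub>V\<^esub>i\<in>{..d} - {k}. E i ?y"
    have R_N: "?R \<in> N" using sum_N by simp
    have Ek_V: "E k ?y \<in> carrier V" using proj_closed[OF less.prems y_V] .
    have R_V: "?R \<in> carrier V" using R_N N_V by blast
    have "(\<Oplus>\<^bsub>V\<^esub>i\<in>insert k ({..d} - {k}). E i ?y) = E k ?y \<oplus>\<^bsub>V\<^esub> ?R"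
      using terms N_V Ek_V by (intro finsum_insert) auto
    moreover have "insert k ({..d} - {k}) = {..d}" using less.prems by auto
    ultimately have split: "?y = E k ?y \<oplus>\<^bsub>V\<^esub> ?R"
      using resolution_of_identity[OF y_V] by simp
    have "E k ?y = ?y \<oplus>\<^bsub>V\<^esub> ((\<ominus>\<^bsub>K\<^esub> \<one>\<^bsub>K\<^esub>) \<odot>\<^bsub>V\<^esub> ?R)"
    proof -
      have "?y \<oplus>\<^bsub>V\<^esub> ((\<ominus>\<^bsub>K\<^esub> \<one>\<^bsub>K\<^esub>) \<odot>\<^bsub>V\<^esub> ?R) = (E k ?y \<oplus>\<^bsub>V\<^esub> ?R) \<oplus>\<^bsub>V\<^esub> (\<ominus>\<^bsub>V\<^esub> ?R)"
        using split R_V by (simp add: smult_minus_1)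
      also have "\<dots> = E k ?y" using Ek_V R_V by (simp add: M.a_assoc M.r_neg)
      finally show ?thesis by simp
    qed
    then have Ek_N: "E k ?y \<in> N" using y_N R_N N_add N_smult by simp
    obtain t where t: "t \<in> carrier K" "E k ?y = t \<odot>\<^bsub>V\<^esub> u k" using proj_scalar[OF less.prems y_V] by blast
    have uk: "u k \<in> carrier V" by (rule frame_carrier[OF less.prems])
    have t_nz: "t \<noteq> \<zero>\<^bsub>K\<^esub>"
    proof
      assume "t = \<zero>\<^bsub>K\<^esub>"
      then have "E k ?y = \<zero>\<^bsub>V\<^esub>" using t(2) uk by simp
      then show False using hessenberg_subdiagonal[OF hess A k] Suc by simp
    qed
    have "u k = inv\<^bsub>K\<^esub> t \<odot>\<^bsub>V\<^esub> E k ?y" using mult_inverse[OF t(1) uk t(2)[symmetric] t_nz] .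
    moreover have "inv\<^bsub>K\<^esub> t \<in> carrier K" using t(1) t_nz field_Units by simp
    ultimately show ?thesis using N_smult Ek_N by simp
  qed
qed

text \<open>
  A map that commutes with \<open>A\<close> is determined by its value at the cyclic vector \<open>u 0\<close>, and the
  Hessenberg shape of \<open>C\<close> leaves for \<open>C (u 0)\<close> only the span of \<open>u 0\<close> and \<open>A (u 0)\<close>. If \<open>d = 0\<close>
  there is no subdiagonal, and \<open>\<alpha>\<close> can be any nonzero scalar; \<open>\<alpha> = 1\<close> is taken.
\<close>

lemma commuting_hessenberg_affine:
  assumes A: "A \<in> carrier (End_alg K V)" and C: "C \<in> carrier (End_alg K V)"
    and hA: "hessenberg K V d E A" and hC: "hessenberg K V d E C"
    and comm: "\<And>x. x \<in> carrier V \<Longrightarrow> C (A x) = A (C x)"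
  shows "\<exists>\<alpha> \<in> carrier K - {\<zero>\<^bsub>K\<^esub>}. \<exists>\<beta> \<in> carrier K. C = affine_map K V \<alpha> \<beta> A"
proof -
  note u0 = frame_carrier[OF le0]
  have Au: "A (u 0) \<in> carrier V" and Cu: "C (u 0) \<in> carrier V"
    using A C u0 End_alg_closed by metis+
  have "\<forall>i \<in> {..d}. \<exists>t. t \<in> carrier K \<and> E i (A (u 0)) = t \<odot>\<^bsub>V\<^esub> u i"
    using proj_scalar Au by (simp add: Bex_def)
  from bchoice[OF this] obtain a
    where a_all: "\<forall>i \<in> {..d}. a i \<in> carrier K \<and> E i (A (u 0)) = a i \<odot>\<^bsub>V\<^esub> u i" by blast
  have a: "a i \<in> carrier K" "E i (A (u 0)) = a i \<odot>\<^bsub>V\<^esub> u i" if "i \<le> d" for i using a_all that by auto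
  have "\<forall>i \<in> {..d}. \<exists>t. t \<in> carrier K \<and> E i (C (u 0)) = t \<odot>\<^bsub>V\<^esub> u i"
    using proj_scalar Cu by (simp add: Bex_def)
  from bchoice[OF this] obtain c
    where c_all: "\<forall>i \<in> {..d}. c i \<in> carrier K \<and> E i (C (u 0)) = c i \<odot>\<^bsub>V\<^esub> u i" by blast
  have c: "c i \<in> carrier K" "E i (C (u 0)) = c i \<odot>\<^bsub>V\<^esub> u i" if "i \<le> d" for i using c_all that by auto
  have nz: "a 1 \<noteq> \<zero>\<^bsub>K\<^esub>" "c 1 \<noteq> \<zero>\<^bsub>K\<^esub>" if "1 \<le> d"
    using hessenberg_subdiagonal[OF hA A, of 0] hessenberg_subdiagonal[OF hC C, of 0]
      a(2)[OF that] c(2)[OF that] frame_carrier[OF that] that by auto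
  have "\<exists>\<alpha> \<in> carrier K. \<alpha> \<noteq> \<zero>\<^bsub>K\<^esub> \<and> (1 \<le> d \<longrightarrow> \<alpha> \<otimes>\<^bsub>K\<^esub> a 1 = c 1)"
  proof (cases "1 \<le> d")
    case True
    note a1 = a(1)[OF True] and c1 = c(1)[OF True]
    have unit: "a 1 \<in> Units K" using a1 nz(1)[OF True] field_Units by simp
    then have inv: "inv\<^bsub>K\<^esub> (a 1) \<in> carrier K" by simp
    have eq: "(c 1 \<otimes>\<^bsub>K\<^esub> inv\<^bsub>K\<^esub> (a 1)) \<otimes>\<^bsub>K\<^esub> a 1 = c 1"
      using c1 inv a1 unit by (simp add: R.m_assoc)
    moreover have "c 1 \<otimes>\<^bsub>K\<^esub> inv\<^bsub>K\<^esub> (a 1) \<noteq> \<zero>\<^bsub>K\<^esub>"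
      using eq nz(2)[OF True] a1 by auto
    ultimately show ?thesis using c1 inv by blast
  next
    case False
    then show ?thesis by (intro bexI[of _ "\<one>\<^bsub>K\<^esub>"]) auto
  qed
  then obtain \<alpha> where \<alpha>: "\<alpha> \<in> carrier K" "\<alpha> \<noteq> \<zero>\<^bsub>K\<^esub>" and \<alpha>1: "1 \<le> d \<Longrightarrow> \<alpha> \<otimes>\<^bsub>K\<^esub> a 1 = c 1"
    by blast
  \<comment> \<open>\<open>\<alpha>\<close> matches the coefficients of \<open>u 1\<close>, and now \<open>\<beta>\<close> those of \<open>u 0\<close>; all others vanish.\<close>
  define \<beta> where "\<beta> = c 0 \<ominus>\<^bsub>K\<^esub> (\<alpha> \<otimes>\<^bsub>K\<^esub> a 0)"
  have \<beta>: "\<beta> \<in> carrier K" using \<alpha> a(1)[OF le0] c(1)[OF le0] unfolding \<beta>_def by simp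
  let ?T = "affine_map K V \<alpha> \<beta> A"
  have T: "?T \<in> carrier (End_alg K V)"
    by (rule affine_map_closed[OF vectorspace_axioms A \<alpha>(1) \<beta>])
  let ?N = "{x \<in> carrier V. C x = ?T x}"
  have Tu: "?T (u 0) = (\<alpha> \<odot>\<^bsub>V\<^esub> A (u 0)) \<oplus>\<^bsub>V\<^esub> (\<beta> \<odot>\<^bsub>V\<^esub> u 0)" by (rule affine_map_apply[OF u0])
  have "C (u 0) = ?T (u 0)"
  proof (rule eq_if_projs_eq[OF Cu End_alg_closed[OF T u0]])
    fix i assume i: "i \<le> d"
    have ET: "E i (?T (u 0)) = (\<alpha> \<odot>\<^bsub>V\<^esub> E i (A (u 0))) \<oplus>\<^bsub>V\<^esub> (\<beta> \<odot>\<^bsub>V\<^esub> E i (u 0))"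
      unfolding Tu using \<alpha>(1) \<beta> Au u0
      by (simp add: module_hom_add[OF proj_hom[OF i]] module_hom_smult[OF proj_hom[OF i]])
    consider "i = 0" | "i = 1" | "1 < i" by linarith
    then show "E i (C (u 0)) = E i (?T (u 0))"
    proof cases
      case 1
      have "E i (?T (u 0)) = ((\<alpha> \<otimes>\<^bsub>K\<^esub> a 0) \<oplus>\<^bsub>K\<^esub> \<beta>) \<odot>\<^bsub>V\<^esub> u 0"
        using ET 1 a[OF le0] proj_frame[OF i le0] \<alpha>(1) \<beta> u0
        by (simp add: smult_l_distr smult_assoc1)
      also have "(\<alpha> \<otimes>\<^bsub>K\<^esub> a 0) \<oplus>\<^bsub>K\<^esub> \<beta> = c 0"
      proof -
        have "x \<oplus>\<^bsub>K\<^esub> (y \<ominus>\<^bsub>K\<^esub> x) = y" if "x \<in> carrier K" "y \<in> carrier K" for x y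
          using that by algebra
        then show ?thesis unfolding \<beta>_def using \<alpha>(1) a(1)[OF le0] c(1)[OF le0] by simp
      qed
      finally show ?thesis using 1 c(2)[OF le0] by simp
    next
      case 2
      then have d: "1 \<le> d" using i by simp
      have "E i (?T (u 0)) = (\<alpha> \<otimes>\<^bsub>K\<^esub> a 1) \<odot>\<^bsub>V\<^esub> u 1"
        using ET 2 a[OF d] proj_frame[OF i le0] \<alpha>(1) \<beta> frame_carrier[OF d]
        by (simp add: smult_assoc1)
      then show ?thesis using 2 c(2)[OF d] \<alpha>1[OF d] by simp
    next
      case 3
      have "E i (A (E 0 (u 0))) = \<zero>\<^bsub>V\<^esub>" "E i (C (E 0 (u 0))) = \<zero>\<^bsub>V\<^esub>"
        using 3 i u0 by (auto intro: hessenberg_zero hA hC)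
      then show ?thesis using ET 3 proj_frame[OF le0 le0] proj_frame[OF i le0] \<alpha>(1) \<beta> by simp
    qed
  qed
  then have u0_N: "u 0 \<in> ?N" using u0 by blast
  have N: "submodule K ?N V"
    by (rule equalizer_submodule[OF End_alg_homD[OF C] End_alg_homD[OF T]])
  have N_inv: "A x \<in> ?N" if "x \<in> ?N" for x
  proof -
    have x: "x \<in> carrier V" and Cx: "C x = ?T x" using that by auto
    have Ax: "A x \<in> carrier V" by (rule End_alg_closed[OF A x])
    have "C (A x) = A ((\<alpha> \<odot>\<^bsub>V\<^esub> A x) \<oplus>\<^bsub>V\<^esub> (\<beta> \<odot>\<^bsub>V\<^esub> x))"
      using comm[OF x] Cx affine_map_apply[OF x] by metis
    also have "\<dots> = (\<alpha> \<odot>\<^bsub>V\<^esub> A (A x)) \<oplus>\<^bsub>V\<^esub> (\<beta> \<odot>\<^bsub>V\<^esub> A x)"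
      using x Ax \<alpha>(1) \<beta> End_add[OF vectorspace_axioms A] End_smult[OF vectorspace_axioms A] by simp
    also have "\<dots> = ?T (A x)" by (rule affine_map_apply[OF Ax, symmetric])
    finally show ?thesis using Ax by blast
  qed
  have "u k \<in> ?N" if "k \<le> d" for k
    by (rule frame_in_invariant_submodule[OF N hA A N_inv u0_N that])
  then have "C x = ?T x" if "x \<in> carrier V" for x
    using frame_induct[OF N _ that] by blast
  then have "C = ?T" by (rule End_alg_eqI[OF C T])
  then show ?thesis using \<alpha> \<beta> by blast
qed

end

section \<open>Affine images of a multiplicity-free map\<close>

context
  fixes K :: "('k, 'm) ring_scheme" and V :: "('k, 'v) module" and A :: "'v \<Rightarrow> 'v" and \<alpha> \<beta> :: 'k
  assumes vs: "vectorspace K V" and A: "A \<in> carrier (End_alg K V)"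
    and \<alpha>: "\<alpha> \<in> carrier K - {\<zero>\<^bsub>K\<^esub>}" and \<beta>: "\<beta> \<in> carrier K"
begin

interpretation vectorspace K V by (rule vs)

lemma affine_eigenspace:
  assumes \<theta>: "\<theta> \<in> carrier K"
  shows "eigenspace V (affine_map K V \<alpha> \<beta> A) ((\<alpha> \<otimes>\<^bsub>K\<^esub> \<theta>) \<oplus>\<^bsub>K\<^esub> \<beta>) = eigenspace V A \<theta>"
proof -
  have \<alpha>_K: "\<alpha> \<in> carrier K" and \<alpha>_nz: "\<alpha> \<noteq> \<zero>\<^bsub>K\<^esub>" using \<alpha> by auto
  have "affine_map K V \<alpha> \<beta> A v = ((\<alpha> \<otimes>\<^bsub>K\<^esub> \<theta>) \<oplus>\<^bsub>K\<^esub> \<beta>) \<odot>\<^bsub>V\<^esub> v \<longleftrightarrow> A v = \<theta> \<odot>\<^bsub>V\<^esub> v"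
    if v: "v \<in> carrier V" for v
  proof -
    have Av: "A v \<in> carrier V" by (rule End_alg_closed[OF A v])
    have "((\<alpha> \<otimes>\<^bsub>K\<^esub> \<theta>) \<oplus>\<^bsub>K\<^esub> \<beta>) \<odot>\<^bsub>V\<^esub> v = (\<alpha> \<odot>\<^bsub>V\<^esub> (\<theta> \<odot>\<^bsub>V\<^esub> v)) \<oplus>\<^bsub>V\<^esub> (\<beta> \<odot>\<^bsub>V\<^esub> v)"
      using \<theta> \<alpha>_K \<beta> v by (simp add: smult_l_distr smult_assoc1)
    then have "affine_map K V \<alpha> \<beta> A v = ((\<alpha> \<otimes>\<^bsub>K\<^esub> \<theta>) \<oplus>\<^bsub>K\<^esub> \<beta>) \<odot>\<^bsub>V\<^esub> v \<longleftrightarrow>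
        \<alpha> \<odot>\<^bsub>V\<^esub> A v = \<alpha> \<odot>\<^bsub>V\<^esub> (\<theta> \<odot>\<^bsub>V\<^esub> v)"
      using affine_map_apply[OF v, where K = K and A = A and \<alpha> = \<alpha> and \<beta> = \<beta>] \<theta> \<alpha>_K \<beta> v Av by simp
    also have "\<dots> \<longleftrightarrow> A v = \<theta> \<odot>\<^bsub>V\<^esub> v"
    proof
      assume eq: "\<alpha> \<odot>\<^bsub>V\<^esub> A v = \<alpha> \<odot>\<^bsub>V\<^esub> (\<theta> \<odot>\<^bsub>V\<^esub> v)"
      have "\<theta> \<odot>\<^bsub>V\<^esub> v \<in> carrier V" using \<theta> v by simp
      then show "A v = \<theta> \<odot>\<^bsub>V\<^esub> v"
        using mult_inverse[OF \<alpha>_K Av eq \<alpha>_nz] mult_inverse[OF \<alpha>_K _ refl \<alpha>_nz, of "\<theta> \<odot>\<^bsub>V\<^esub> v"] by simp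
    qed simp
    finally show ?thesis .
  qed
  then show ?thesis unfolding eigenspace_def by blast
qed

lemma affine_root:
  assumes "\<phi> \<in> carrier K"
  shows "\<exists>\<theta> \<in> carrier K. \<phi> = (\<alpha> \<otimes>\<^bsub>K\<^esub> \<theta>) \<oplus>\<^bsub>K\<^esub> \<beta>"
proof (rule bexI)
  let ?t = "inv\<^bsub>K\<^esub> \<alpha> \<otimes>\<^bsub>K\<^esub> (\<phi> \<ominus>\<^bsub>K\<^esub> \<beta>)"
  have unit: "\<alpha> \<in> Units K" using \<alpha> field_Units by simp
  then have inv: "inv\<^bsub>K\<^esub> \<alpha> \<in> carrier K" by simp
  then show "?t \<in> carrier K" using assms \<beta> by simp
  have "\<alpha> \<otimes>\<^bsub>K\<^esub> ?t = (\<alpha> \<otimes>\<^bsub>K\<^esub> inv\<^bsub>K\<^esub> \<alpha>) \<otimes>\<^bsub>K\<^esub> (\<phi> \<ominus>\<^bsub>K\<^esub> \<beta>)"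
    using \<alpha> inv assms \<beta> by (simp add: R.m_assoc)
  also have "\<dots> = \<phi> \<ominus>\<^bsub>K\<^esub> \<beta>" using unit assms \<beta> by simp
  finally have "(\<alpha> \<otimes>\<^bsub>K\<^esub> ?t) \<oplus>\<^bsub>K\<^esub> \<beta> = (\<phi> \<ominus>\<^bsub>K\<^esub> \<beta>) \<oplus>\<^bsub>K\<^esub> \<beta>" by simp
  also have "\<dots> = \<phi>" using assms \<beta> by algebra
  finally show "\<phi> = (\<alpha> \<otimes>\<^bsub>K\<^esub> ?t) \<oplus>\<^bsub>K\<^esub> \<beta>" by simp
qed

lemma affine_inj:
  assumes "\<theta> \<in> carrier K" "\<eta> \<in> carrier K"
  shows "(\<alpha> \<otimes>\<^bsub>K\<^esub> \<theta>) \<oplus>\<^bsub>K\<^esub> \<beta> = (\<alpha> \<otimes>\<^bsub>K\<^esub> \<eta>) \<oplus>\<^bsub>K\<^esub> \<beta> \<longleftrightarrow> \<theta> = \<eta>"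
proof
  assume "(\<alpha> \<otimes>\<^bsub>K\<^esub> \<theta>) \<oplus>\<^bsub>K\<^esub> \<beta> = (\<alpha> \<otimes>\<^bsub>K\<^esub> \<eta>) \<oplus>\<^bsub>K\<^esub> \<beta>"
  then have "\<alpha> \<otimes>\<^bsub>K\<^esub> \<theta> = \<alpha> \<otimes>\<^bsub>K\<^esub> \<eta>" using assms \<alpha> \<beta> by simp
  then show "\<theta> = \<eta>" using m_lcancel[of \<alpha> \<theta> \<eta>] assms \<alpha> by simp
qed simp

lemma affine_eigenvalues:
  "eigenvalues K V (affine_map K V \<alpha> \<beta> A) = (\<lambda>\<theta>. (\<alpha> \<otimes>\<^bsub>K\<^esub> \<theta>) \<oplus>\<^bsub>K\<^esub> \<beta>) ` eigenvalues K V A"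
proof (intro equalityI subsetI)
  fix \<phi> assume \<phi>: "\<phi> \<in> eigenvalues K V (affine_map K V \<alpha> \<beta> A)"
  then have "\<phi> \<in> carrier K" unfolding eigenvalues_def by blast
  then obtain \<theta> where \<theta>: "\<theta> \<in> carrier K" "\<phi> = (\<alpha> \<otimes>\<^bsub>K\<^esub> \<theta>) \<oplus>\<^bsub>K\<^esub> \<beta>"
    using affine_root by blast
  then have "\<theta> \<in> eigenvalues K V A"
    using \<phi> affine_eigenspace[OF \<theta>(1)] unfolding eigenvalues_def by auto
  then show "\<phi> \<in> (\<lambda>\<theta>. (\<alpha> \<otimes>\<^bsub>K\<^esub> \<theta>) \<oplus>\<^bsub>K\<^esub> \<beta>) ` eigenvalues K V A" using \<theta> by blast
next
  fix \<phi> assume "\<phi> \<in> (\<lambda>\<theta>. (\<alpha> \<otimes>\<^bsub>K\<^esub> \<theta>) \<oplus>\<^bsub>K\<^esub> \<beta>) ` eigenvalues K V A"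
  then show "\<phi> \<in> eigenvalues K V (affine_map K V \<alpha> \<beta> A)"
    using affine_eigenspace \<alpha> \<beta> unfolding eigenvalues_def by auto
qed

lemma eigenvalue_closed: "\<theta> \<in> eigenvalues K V A \<Longrightarrow> \<theta> \<in> carrier K"
  unfolding eigenvalues_def by blast

lemma affine_primitive_idempotents:
  "primitive_idempotents K V (affine_map K V \<alpha> \<beta> A) = primitive_idempotents K V A"
proof -
  let ?f = "\<lambda>\<theta>. (\<alpha> \<otimes>\<^bsub>K\<^esub> \<theta>) \<oplus>\<^bsub>K\<^esub> \<beta>"
  let ?B = "affine_map K V \<alpha> \<beta> A"
  have inj: "inj_on ?f (eigenvalues K V A)"
    using affine_inj eigenvalue_closed by (auto intro!: inj_onI)
  have "(\<exists>\<phi> \<in> eigenvalues K V ?B. (\<forall>v \<in> eigenspace V ?B \<phi>. P v = v) \<and>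
        (\<forall>\<phi>' \<in> eigenvalues K V ?B - {\<phi>}. \<forall>v \<in> eigenspace V ?B \<phi>'. P v = \<zero>\<^bsub>V\<^esub>)) \<longleftrightarrow>
      (\<exists>\<theta> \<in> eigenvalues K V A. (\<forall>v \<in> eigenspace V A \<theta>. P v = v) \<and>
        (\<forall>\<theta>' \<in> eigenvalues K V A - {\<theta>}. \<forall>v \<in> eigenspace V A \<theta>'. P v = \<zero>\<^bsub>V\<^esub>))" for P
  proof -
    have diff: "?f ` eigenvalues K V A - {?f \<theta>} = ?f ` (eigenvalues K V A - {\<theta>})"
      if "\<theta> \<in> eigenvalues K V A" for \<theta>
      using that inj_on_image_set_diff[OF inj, of "eigenvalues K V A" "{\<theta>}"] by auto
    have space: "eigenspace V ?B (?f \<theta>) = eigenspace V A \<theta>" if "\<theta> \<in> eigenvalues K V A" for \<theta>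
      using affine_eigenspace eigenvalue_closed[OF that] by blast
    show ?thesis
      unfolding affine_eigenvalues bex_simps(7)
      by (rule bex_cong[OF refl]) (simp add: diff space)
  qed
  then show ?thesis unfolding primitive_idempotents_def by blast
qed

lemma affine_multiplicity_free:
  assumes "multiplicity_free K V A"
  shows "multiplicity_free K V (affine_map K V \<alpha> \<beta> A)"
  unfolding multiplicity_free_def
proof
  obtain B where B: "basis B" "\<forall>v \<in> B. \<exists>\<theta> \<in> carrier K. v \<in> eigenspace V A \<theta>"
    using assms unfolding multiplicity_free_def diagonalizable_def by blast
  have "\<exists>\<phi> \<in> carrier K. v \<in> eigenspace V (affine_map K V \<alpha> \<beta> A) \<phi>" if v: "v \<in> B" for v
  proof -
    obtain \<theta> where \<theta>: "\<theta> \<in> carrier K" "v \<in> eigenspace V A \<theta>" using B(2) v by blast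
    have "(\<alpha> \<otimes>\<^bsub>K\<^esub> \<theta>) \<oplus>\<^bsub>K\<^esub> \<beta> \<in> carrier K" using \<theta>(1) \<alpha> \<beta> by simp
    then show ?thesis using \<theta>(2) unfolding affine_eigenspace[OF \<theta>(1), symmetric] by blast
  qed
  then show "diagonalizable K V (affine_map K V \<alpha> \<beta> A)"
    using B(1) unfolding diagonalizable_def by blast
  show "\<forall>\<phi> \<in> eigenvalues K V (affine_map K V \<alpha> \<beta> A).
      vectorspace.dim K (V\<lparr>carrier := eigenspace V (affine_map K V \<alpha> \<beta> A) \<phi>\<rparr>) = 1"
    unfolding affine_eigenvalues
    using assms affine_eigenspace eigenvalue_closed unfolding multiplicity_free_def by auto
qed

text \<open>
The identity contributes \<open>\<beta> F i F j = 0\<close> to an off-diagonal product, so such a product is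
multiplied by \<open>\<alpha>\<close>.
\<close>

lemma affine_hessenberg:
  assumes frame: "idempotent_frame K V d u F" and hess: "hessenberg K V d F A"
  shows "hessenberg K V d F (affine_map K V \<alpha> \<beta> A)"
proof -
  interpret F: idempotent_frame K V d u F by (rule frame)
  let ?B = "affine_map K V \<alpha> \<beta> A"
  have off: "F i \<otimes>\<^bsub>End_alg K V\<^esub> ?B \<otimes>\<^bsub>End_alg K V\<^esub> F j = \<alpha> \<odot>\<^bsub>End_alg K V\<^esub> (F i \<otimes>\<^bsub>End_alg K V\<^esub> A \<otimes>\<^bsub>End_alg K V\<^esub> F j)"
    if i: "i \<le> d" and j: "j \<le> d" and ij: "i \<noteq> j" for i j
  proof (rule ext)
    fix x
    show "(F i \<otimes>\<^bsub>End_alg K V\<^esub> ?B \<otimes>\<^bsub>End_alg K V\<^esub> F j) x = (\<alpha> \<odot>\<^bsub>End_alg K V\<^esub> (F i \<otimes>\<^bsub>End_alg K V\<^esub> A \<otimes>\<^bsub>End_alg K V\<^esub> F j)) x"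
    proof (cases "x \<in> carrier V")
      case x: True
      have Fx: "F j x \<in> carrier V" by (rule F.proj_closed[OF j x])
      have AFx: "A (F j x) \<in> carrier V" by (rule End_alg_closed[OF A Fx])
      have "F i (?B (F j x)) = (\<alpha> \<odot>\<^bsub>V\<^esub> F i (A (F j x))) \<oplus>\<^bsub>V\<^esub> (\<beta> \<odot>\<^bsub>V\<^esub> F i (F j x))"
        using \<alpha> \<beta> Fx AFx affine_map_apply[OF Fx, where K = K and A = A and \<alpha> = \<alpha> and \<beta> = \<beta>]
        by (simp add: module_hom_add[OF F.proj_hom[OF i]] module_hom_smult[OF F.proj_hom[OF i]])
      also have "\<dots> = \<alpha> \<odot>\<^bsub>V\<^esub> F i (A (F j x))"
        using F.proj_proj[OF i j x] ij \<alpha> \<beta> F.proj_closed[OF i AFx] by simp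
      finally show ?thesis
        using x Fx by (simp add: End_alg_simps(2,6) compose_def)
    next
      case False
      then show ?thesis by (simp add: End_alg_simps(2,6) compose_def)
    qed
  qed
  have scale: "\<alpha> \<odot>\<^bsub>End_alg K V\<^esub> T = \<zero>\<^bsub>End_alg K V\<^esub> \<longleftrightarrow> T = \<zero>\<^bsub>End_alg K V\<^esub>" if T: "T \<in> carrier (End_alg K V)" for T
  proof
    assume eq: "\<alpha> \<odot>\<^bsub>End_alg K V\<^esub> T = \<zero>\<^bsub>End_alg K V\<^esub>"
    have "T x = \<zero>\<^bsub>End_alg K V\<^esub> x" if x: "x \<in> carrier V" for x
    proof -
      have "(\<alpha> \<odot>\<^bsub>End_alg K V\<^esub> T) x = \<zero>\<^bsub>End_alg K V\<^esub> x" using eq by simp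
      then have "\<alpha> \<odot>\<^bsub>V\<^esub> T x = \<zero>\<^bsub>V\<^esub>" using x by (simp add: End_alg_simps(4,6))
      then have "T x = \<zero>\<^bsub>V\<^esub>" using smult_eq_zeroD[of \<alpha> "T x"] End_alg_closed[OF T x] \<alpha> by blast
      then show ?thesis using x by (simp add: End_alg_simps(4))
    qed
    then show "T = \<zero>\<^bsub>End_alg K V\<^esub>" by (rule End_alg_eqI[OF T End_zero_closed[OF vs]])
  next
    assume "T = \<zero>\<^bsub>End_alg K V\<^esub>"
    then show "\<alpha> \<odot>\<^bsub>End_alg K V\<^esub> T = \<zero>\<^bsub>End_alg K V\<^esub>"
      using \<alpha> by (auto simp: End_alg_simps(4,6))
  qed
  have prod: "F i \<otimes>\<^bsub>End_alg K V\<^esub> A \<otimes>\<^bsub>End_alg K V\<^esub> F j = \<zero>\<^bsub>End_alg K V\<^esub> \<longleftrightarrow> F i \<otimes>\<^bsub>End_alg K V\<^esub> ?B \<otimes>\<^bsub>End_alg K V\<^esub> F j = \<zero>\<^bsub>End_alg K V\<^esub>"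
    if i: "i \<le> d" and j: "j \<le> d" and ij: "i \<noteq> j" for i j
  proof -
    have "F i \<otimes>\<^bsub>End_alg K V\<^esub> A \<otimes>\<^bsub>End_alg K V\<^esub> F j \<in> carrier (End_alg K V)"
    proof (rule End_algI[OF vs])
      show "F i \<otimes>\<^bsub>End_alg K V\<^esub> A \<otimes>\<^bsub>End_alg K V\<^esub> F j \<in> extensional (carrier V)"
        by (simp add: End_alg_simps(2) compose_extensional)
      show "(F i \<otimes>\<^bsub>End_alg K V\<^esub> A \<otimes>\<^bsub>End_alg K V\<^esub> F j) x \<in> carrier V" if "x \<in> carrier V" for x
        using that End_mult3_apply[where K = K and R = "F i" and S = A and T = "F j", OF that]
          F.proj_closed[OF j that] End_alg_closed[OF A] F.proj_closed[OF i] by simp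
      show "(F i \<otimes>\<^bsub>End_alg K V\<^esub> A \<otimes>\<^bsub>End_alg K V\<^esub> F j) (x \<oplus>\<^bsub>V\<^esub> y) = (F i \<otimes>\<^bsub>End_alg K V\<^esub> A \<otimes>\<^bsub>End_alg K V\<^esub> F j) x \<oplus>\<^bsub>V\<^esub> (F i \<otimes>\<^bsub>End_alg K V\<^esub> A \<otimes>\<^bsub>End_alg K V\<^esub> F j) y"
        if x: "x \<in> carrier V" and y: "y \<in> carrier V" for x y
        using x y F.proj_closed[OF j x] F.proj_closed[OF j y] End_alg_closed[OF A]
        by (simp add: End_alg_simps(2) compose_def End_add[OF vs A]
          module_hom_add[OF F.proj_hom[OF i]] module_hom_add[OF F.proj_hom[OF j]])
      show "(F i \<otimes>\<^bsub>End_alg K V\<^esub> A \<otimes>\<^bsub>End_alg K V\<^esub> F j) (c \<odot>\<^bsub>V\<^esub> x) = c \<odot>\<^bsub>V\<^esub> (F i \<otimes>\<^bsub>End_alg K V\<^esub> A \<otimes>\<^bsub>End_alg K V\<^esub> F j) x"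
        if c: "c \<in> carrier K" and x: "x \<in> carrier V" for c x
        using c x F.proj_closed[OF j x] End_alg_closed[OF A]
        by (simp add: End_alg_simps(2) compose_def End_smult[OF vs A]
          module_hom_smult[OF F.proj_hom[OF i]] module_hom_smult[OF F.proj_hom[OF j]])
    qed
    then show ?thesis using off[OF i j ij] scale by simp
  qed
  show ?thesis
    using hess prod unfolding hessenberg_def by auto
qed

end

section \<open>Isomorphisms of endomorphism algebras\<close>

lemma End_alg_isoD:
  assumes "\<gamma> \<in> End_alg_iso K V W"
  shows "bij_betw \<gamma> (carrier (End_alg K V)) (carrier (End_alg K W))"
    and "T \<in> carrier (End_alg K V) \<Longrightarrow> \<gamma> T \<in> carrier (End_alg K W)"
    and "S \<in> carrier (End_alg K V) \<Longrightarrow> T \<in> carrier (End_alg K V) \<Longrightarrow> \<gamma> (S \<otimes>\<^bsub>End_alg K V\<^esub> T) = \<gamma> S \<otimes>\<^bsub>End_alg K W\<^esub> \<gamma> T"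
    and "S \<in> carrier (End_alg K V) \<Longrightarrow> T \<in> carrier (End_alg K V) \<Longrightarrow> \<gamma> (S \<oplus>\<^bsub>End_alg K V\<^esub> T) = \<gamma> S \<oplus>\<^bsub>End_alg K W\<^esub> \<gamma> T"
    and "c \<in> carrier K \<Longrightarrow> T \<in> carrier (End_alg K V) \<Longrightarrow> \<gamma> (c \<odot>\<^bsub>End_alg K V\<^esub> T) = c \<odot>\<^bsub>End_alg K W\<^esub> \<gamma> T"
    and "\<gamma> \<one>\<^bsub>End_alg K V\<^esub> = \<one>\<^bsub>End_alg K W\<^esub>"
proof -
  have ring: "\<gamma> \<in> ring_hom (End_alg K V) (End_alg K W)"
    and bij: "bij_betw \<gamma> (carrier (End_alg K V)) (carrier (End_alg K W))"
    and smult: "\<gamma> \<in> module_hom K (End_alg K V) (End_alg K W)"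
    using assms unfolding End_alg_iso_def ring_iso_def by auto
  show "bij_betw \<gamma> (carrier (End_alg K V)) (carrier (End_alg K W))" by (rule bij)
  show "T \<in> carrier (End_alg K V) \<Longrightarrow> \<gamma> T \<in> carrier (End_alg K W)"
    by (rule ring_hom_closed[OF ring])
  show "S \<in> carrier (End_alg K V) \<Longrightarrow> T \<in> carrier (End_alg K V) \<Longrightarrow> \<gamma> (S \<otimes>\<^bsub>End_alg K V\<^esub> T) = \<gamma> S \<otimes>\<^bsub>End_alg K W\<^esub> \<gamma> T"
    by (rule ring_hom_mult[OF ring])
  show "S \<in> carrier (End_alg K V) \<Longrightarrow> T \<in> carrier (End_alg K V) \<Longrightarrow> \<gamma> (S \<oplus>\<^bsub>End_alg K V\<^esub> T) = \<gamma> S \<oplus>\<^bsub>End_alg K W\<^esub> \<gamma> T"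
    by (rule ring_hom_add[OF ring])
  show "c \<in> carrier K \<Longrightarrow> T \<in> carrier (End_alg K V) \<Longrightarrow> \<gamma> (c \<odot>\<^bsub>End_alg K V\<^esub> T) = c \<odot>\<^bsub>End_alg K W\<^esub> \<gamma> T"
    by (rule module_hom_smult[OF smult])
  show "\<gamma> \<one>\<^bsub>End_alg K V\<^esub> = \<one>\<^bsub>End_alg K W\<^esub>"
    by (rule ring_hom_one[OF ring])
qed

lemma End_alg_isoI:
  assumes "bij_betw \<gamma> (carrier (End_alg K V)) (carrier (End_alg K W))"
    and "\<And>S T. S \<in> carrier (End_alg K V) \<Longrightarrow> T \<in> carrier (End_alg K V) \<Longrightarrow> \<gamma> (S \<otimes>\<^bsub>End_alg K V\<^esub> T) = \<gamma> S \<otimes>\<^bsub>End_alg K W\<^esub> \<gamma> T"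
    and "\<And>S T. S \<in> carrier (End_alg K V) \<Longrightarrow> T \<in> carrier (End_alg K V) \<Longrightarrow> \<gamma> (S \<oplus>\<^bsub>End_alg K V\<^esub> T) = \<gamma> S \<oplus>\<^bsub>End_alg K W\<^esub> \<gamma> T"
    and "\<And>c T. c \<in> carrier K \<Longrightarrow> T \<in> carrier (End_alg K V) \<Longrightarrow> \<gamma> (c \<odot>\<^bsub>End_alg K V\<^esub> T) = c \<odot>\<^bsub>End_alg K W\<^esub> \<gamma> T"
    and "\<gamma> \<one>\<^bsub>End_alg K V\<^esub> = \<one>\<^bsub>End_alg K W\<^esub>"
  shows "\<gamma> \<in> End_alg_iso K V W"
proof -
  have closed: "\<gamma> T \<in> carrier (End_alg K W)" if "T \<in> carrier (End_alg K V)" for T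
    using bij_betwE[OF assms(1)] that by blast
  have "\<gamma> \<in> ring_hom (End_alg K V) (End_alg K W)"
    by (rule ring_hom_memI) (simp_all add: assms closed)
  moreover have "\<gamma> \<in> module_hom K (End_alg K V) (End_alg K W)"
    unfolding module_hom_def using closed assms by blast
  ultimately show ?thesis
    using assms(1) unfolding End_alg_iso_def ring_iso_def by blast
qed

lemma End_alg_iso_refl: "(\<lambda>T. T) \<in> End_alg_iso K V V"
  by (rule End_alg_isoI) (simp_all add: bij_betw_def)

lemma End_alg_iso_sym:
  fixes V :: "('k, 'v) module"
  assumes vs: "vectorspace K V" and \<gamma>: "\<gamma> \<in> End_alg_iso K V W"
  shows "the_inv_into (carrier (End_alg K V)) \<gamma> \<in> End_alg_iso K W V"
proof (rule End_alg_isoI)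
  note iso = End_alg_isoD[OF \<gamma>]
  let ?h = "the_inv_into (carrier (End_alg K V)) \<gamma>"
  have inj: "inj_on \<gamma> (carrier (End_alg K V))" using iso(1) by (rule bij_betw_imp_inj_on)
  have h: "?h (\<gamma> T) = T" if "T \<in> carrier (End_alg K V)" for T
    using the_inv_into_f_f[OF inj that] .
  have onto: "\<exists>T' \<in> carrier (End_alg K V). T = \<gamma> T'" if "T \<in> carrier (End_alg K W)" for T
    using bij_betw_imp_surj_on[OF iso(1)] that by blast
  show "bij_betw ?h (carrier (End_alg K W)) (carrier (End_alg K V))"
    by (rule bij_betw_the_inv_into[OF iso(1)])
  show "?h (S \<otimes>\<^bsub>End_alg K W\<^esub> T) = ?h S \<otimes>\<^bsub>End_alg K V\<^esub> ?h T"
    if S: "S \<in> carrier (End_alg K W)" and T: "T \<in> carrier (End_alg K W)" for S T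
  proof -
    obtain S' T' where "S' \<in> carrier (End_alg K V)" "T' \<in> carrier (End_alg K V)" "S = \<gamma> S'" "T = \<gamma> T'"
      using onto[OF S] onto[OF T] by blast
    then show ?thesis by (simp add: iso(3)[symmetric] h End_mult_closed[OF vs])
  qed
  show "?h (S \<oplus>\<^bsub>End_alg K W\<^esub> T) = ?h S \<oplus>\<^bsub>End_alg K V\<^esub> ?h T"
    if S: "S \<in> carrier (End_alg K W)" and T: "T \<in> carrier (End_alg K W)" for S T
  proof -
    obtain S' T' where "S' \<in> carrier (End_alg K V)" "T' \<in> carrier (End_alg K V)" "S = \<gamma> S'" "T = \<gamma> T'"
      using onto[OF S] onto[OF T] by blast
    then show ?thesis by (simp add: iso(4)[symmetric] h End_add_closed[OF vs])
  qed
  show "?h (c \<odot>\<^bsub>End_alg K W\<^esub> T) = c \<odot>\<^bsub>End_alg K V\<^esub> ?h T"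
    if c: "c \<in> carrier K" and T: "T \<in> carrier (End_alg K W)" for c T
  proof -
    obtain T' where "T' \<in> carrier (End_alg K V)" "T = \<gamma> T'"
      using onto[OF T] by blast
    then show ?thesis using c by (simp add: iso(5)[symmetric] h End_smult_closed[OF vs])
  qed
  show "?h \<one>\<^bsub>End_alg K W\<^esub> = \<one>\<^bsub>End_alg K V\<^esub>"
    using h[OF End_one_closed[OF vs]] iso(6) by simp
qed

lemma End_alg_iso_trans:
  fixes \<gamma> :: "('v \<Rightarrow> 'v) \<Rightarrow> ('w \<Rightarrow> 'w)" and \<delta> :: "('w \<Rightarrow> 'w) \<Rightarrow> ('x \<Rightarrow> 'x)"
  assumes \<gamma>: "\<gamma> \<in> End_alg_iso K V W" and \<delta>: "\<delta> \<in> End_alg_iso K W X"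
  shows "(\<lambda>T. \<delta> (\<gamma> T)) \<in> End_alg_iso K V X"
proof (rule End_alg_isoI)
  show "bij_betw (\<lambda>T. \<delta> (\<gamma> T)) (carrier (End_alg K V)) (carrier (End_alg K X))"
    using bij_betw_trans[OF End_alg_isoD(1)[OF \<gamma>] End_alg_isoD(1)[OF \<delta>]] by (simp add: comp_def)
qed (simp_all add: End_alg_isoD(2-6)[OF \<gamma>] End_alg_isoD(2-6)[OF \<delta>])

lemma End_alg_iso_zero:
  fixes V :: "('k, 'v) module" and W :: "('k, 'w) module"
  assumes vsV: "vectorspace K V" and vsW: "vectorspace K W" and \<gamma>: "\<gamma> \<in> End_alg_iso K V W"
  shows "\<gamma> \<zero>\<^bsub>End_alg K V\<^esub> = \<zero>\<^bsub>End_alg K W\<^esub>"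
proof -
  interpret V: vectorspace K V by (rule vsV)
  interpret W: vectorspace K W by (rule vsW)
  have "\<zero>\<^bsub>K\<^esub> \<odot>\<^bsub>End_alg K V\<^esub> \<zero>\<^bsub>End_alg K V\<^esub> = \<zero>\<^bsub>End_alg K V\<^esub>" by (rule ext) (simp add: End_alg_simps)
  then have "\<gamma> \<zero>\<^bsub>End_alg K V\<^esub> = \<zero>\<^bsub>K\<^esub> \<odot>\<^bsub>End_alg K W\<^esub> \<gamma> \<zero>\<^bsub>End_alg K V\<^esub>"
    using End_alg_isoD(5)[OF \<gamma> _ End_zero_closed[OF vsV], of "\<zero>\<^bsub>K\<^esub>"] by simp
  also have "\<dots> = \<zero>\<^bsub>End_alg K W\<^esub>"
    using End_alg_closed[OF End_alg_isoD(2)[OF \<gamma> End_zero_closed[OF vsV]]]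
    by (intro ext) (simp add: End_alg_simps(4,6))
  finally show ?thesis .
qed

lemma End_alg_iso_hessenberg:
  fixes V :: "('k, 'v) module" and W :: "('k, 'w) module"
  assumes vsV: "vectorspace K V" and vsW: "vectorspace K W" and \<gamma>: "\<gamma> \<in> End_alg_iso K V W"
    and hess: "hessenberg K V d F X" and X: "X \<in> carrier (End_alg K V)"
    and F: "\<And>i. i \<le> d \<Longrightarrow> F i \<in> carrier (End_alg K V)" and G: "\<And>i. i \<le> d \<Longrightarrow> G i = \<gamma> (F i)"
  shows "hessenberg K W d G (\<gamma> X)"
proof -
  have "G i \<otimes>\<^bsub>End_alg K W\<^esub> \<gamma> X \<otimes>\<^bsub>End_alg K W\<^esub> G j = \<zero>\<^bsub>End_alg K W\<^esub> \<longleftrightarrow> F i \<otimes>\<^bsub>End_alg K V\<^esub> X \<otimes>\<^bsub>End_alg K V\<^esub> F j = \<zero>\<^bsub>End_alg K V\<^esub>"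
    if i: "i \<le> d" and j: "j \<le> d" for i j
  proof -
    have FX: "F i \<otimes>\<^bsub>End_alg K V\<^esub> X \<in> carrier (End_alg K V)" by (rule End_mult_closed[OF vsV F[OF i] X])
    have FXF: "F i \<otimes>\<^bsub>End_alg K V\<^esub> X \<otimes>\<^bsub>End_alg K V\<^esub> F j \<in> carrier (End_alg K V)"
      by (rule End_mult_closed[OF vsV FX F[OF j]])
    have "G i \<otimes>\<^bsub>End_alg K W\<^esub> \<gamma> X \<otimes>\<^bsub>End_alg K W\<^esub> G j = \<gamma> (F i \<otimes>\<^bsub>End_alg K V\<^esub> X \<otimes>\<^bsub>End_alg K V\<^esub> F j)"
      using End_alg_isoD(3)[OF \<gamma> FX F[OF j]] End_alg_isoD(3)[OF \<gamma> F[OF i] X] G i j by simp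
    then show ?thesis
      unfolding End_alg_iso_zero[OF vsV vsW \<gamma>, symmetric]
      by (simp only: inj_on_eq_iff[OF bij_betw_imp_inj_on[OF End_alg_isoD(1)[OF \<gamma>]]
            FXF End_zero_closed[OF vsV]])
  qed
  then show ?thesis using hess unfolding hessenberg_def by simp
qed

section \<open>TH systems and their reductions\<close>

lemma is_TH_system_iff:
  "is_TH_system K d V A E As Es \<longleftrightarrow>
    vectorspace K V \<and> vectorspace.fin_dim K V \<and> vectorspace.dim K V = d + 1 \<and>
    A \<in> carrier (End_alg K V) \<and> As \<in> carrier (End_alg K V) \<and>
    multiplicity_free K V A \<and> multiplicity_free K V As \<and>
    idempotent_ordering K d V A E \<and> idempotent_ordering K d V As Es \<and>
    hessenberg K V d E As \<and> hessenberg K V d Es A"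
  unfolding is_TH_system_def hessenberg_def by blast

text \<open>
The axioms are symmetric in the two halves of a system, so each argument about \<open>A\<close> also covers
\<open>As\<close>.
\<close>

lemma is_TH_system_swap: "is_TH_system K d V A E As Es \<Longrightarrow> is_TH_system K d V As Es A E"
  unfolding is_TH_system_iff by blast

lemma TH_system_frame:
  assumes "is_TH_system K d V A E As Es"
  shows "\<exists>u \<theta>. idempotent_frame K V d u E \<and>
    (\<forall>i \<le> d. \<theta> i \<in> carrier K \<and> A (u i) = \<theta> i \<odot>\<^bsub>V\<^esub> u i)"
  using assms unfolding is_TH_system_iff multiplicity_free_def
  by (intro idempotent_frame_exists) auto

lemma TH_system_idempotent_closed:
  assumes "is_TH_system K d V A E As Es" "i \<le> d"
  shows "E i \<in> carrier (End_alg K V)"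
proof -
  have "bij_betw E {..d} (primitive_idempotents K V A)"
    using assms(1) unfolding is_TH_system_iff idempotent_ordering_def by blast
  then have "E i \<in> primitive_idempotents K V A" using assms(2) by (auto dest: bij_betwE)
  then show ?thesis unfolding primitive_idempotents_def by blast
qed

lemma is_TH_system_affine_left:
  assumes TH: "is_TH_system K d V A E As Es" and "\<alpha> \<in> carrier K - {\<zero>\<^bsub>K\<^esub>}" "\<beta> \<in> carrier K"
  shows "is_TH_system K d V (affine_map K V \<alpha> \<beta> A) E As Es"
proof -
  have vs: "vectorspace K V" and A: "A \<in> carrier (End_alg K V)"
    using TH unfolding is_TH_system_iff by blast+
  note ctx = vs A assms(2,3)
  obtain w where w: "idempotent_frame K V d w Es"
    using TH_system_frame[OF is_TH_system_swap[OF TH]] by blast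
  have "affine_map K V \<alpha> \<beta> A \<in> carrier (End_alg K V)"
    using affine_map_closed[OF vs A] assms(2,3) by blast
  moreover have "multiplicity_free K V (affine_map K V \<alpha> \<beta> A)"
    using affine_multiplicity_free[OF ctx] TH unfolding is_TH_system_iff by blast
  moreover have "idempotent_ordering K d V (affine_map K V \<alpha> \<beta> A) E"
    using TH unfolding is_TH_system_iff idempotent_ordering_def affine_primitive_idempotents[OF ctx] by blast
  moreover have "hessenberg K V d Es (affine_map K V \<alpha> \<beta> A)"
    using affine_hessenberg[OF ctx w] TH unfolding is_TH_system_iff by blast
  ultimately show ?thesis using TH unfolding is_TH_system_iff by blast
qed

lemma is_TH_system_affine:
  assumes "is_TH_system K d V A E As Es"
    and "\<alpha> \<in> carrier K - {\<zero>\<^bsub>K\<^esub>}" "\<beta> \<in> carrier K" "\<alpha>s \<in> carrier K - {\<zero>\<^bsub>K\<^esub>}" "\<beta>s \<in> carrier K"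
  shows "is_TH_system K d V (affine_map K V \<alpha> \<beta> A) E (affine_map K V \<alpha>s \<beta>s As) Es"
  by (intro is_TH_system_swap[OF is_TH_system_affine_left[OF
        is_TH_system_swap[OF is_TH_system_affine_left]]] assms)

text \<open>
  The relation \<open>A E i = \<theta> i E i\<close> is carried by \<open>\<gamma>\<close> to \<open>\<gamma> A F i = \<theta> i F i\<close>. Thus \<open>\<gamma> A\<close> and \<open>B\<close> are diagonal
  in the same basis and commute, while \<open>\<gamma>\<close> also preserves the Hessenberg conditions.
\<close>

lemma transported_map_affine:
  fixes V :: "('k, 'v) module" and W :: "('k, 'w) module"
  assumes THV: "is_TH_system K d V A E As Es" and THW: "is_TH_system K d W B F Bs Fs"
    and \<gamma>: "\<gamma> \<in> End_alg_iso K V W"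
    and F: "\<And>i. i \<le> d \<Longrightarrow> F i = \<gamma> (E i)" and Fs: "\<And>i. i \<le> d \<Longrightarrow> Fs i = \<gamma> (Es i)"
  shows "\<exists>\<alpha> \<in> carrier K - {\<zero>\<^bsub>K\<^esub>}. \<exists>\<beta> \<in> carrier K. \<gamma> A = affine_map K W \<alpha> \<beta> B"
proof -
  have vsV: "vectorspace K V" and A: "A \<in> carrier (End_alg K V)" and hA: "hessenberg K V d Es A"
    using THV unfolding is_TH_system_iff by blast+
  have vsW: "vectorspace K W" and B: "B \<in> carrier (End_alg K W)" and hB: "hessenberg K W d Fs B"
    using THW unfolding is_TH_system_iff by blast+
  obtain u \<theta> where u: "idempotent_frame K V d u E"
    and \<theta>: "\<And>i. i \<le> d \<Longrightarrow> \<theta> i \<in> carrier K" "\<And>i. i \<le> d \<Longrightarrow> A (u i) = \<theta> i \<odot>\<^bsub>V\<^esub> u i"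
    using TH_system_frame[OF THV] by blast
  obtain r \<eta> where r: "idempotent_frame K W d r F"
    and \<eta>: "\<And>i. i \<le> d \<Longrightarrow> \<eta> i \<in> carrier K" "\<And>i. i \<le> d \<Longrightarrow> B (r i) = \<eta> i \<odot>\<^bsub>W\<^esub> r i"
    using TH_system_frame[OF THW] by blast
  obtain w where w: "idempotent_frame K W d w Fs"
    using TH_system_frame[OF is_TH_system_swap[OF THW]] by blast
  interpret u: idempotent_frame K V d u E by (rule u)
  interpret r: idempotent_frame K W d r F by (rule r)
  interpret w: idempotent_frame K W d w Fs by (rule w)
  have \<gamma>A: "\<gamma> A \<in> carrier (End_alg K W)" by (rule End_alg_isoD(2)[OF \<gamma> A])
  have \<gamma>A_r: "\<gamma> A (r i) = \<theta> i \<odot>\<^bsub>W\<^esub> r i" if i: "i \<le> d" for i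
  proof -
    have Ei: "E i \<in> carrier (End_alg K V)" by (rule TH_system_idempotent_closed[OF THV i])
    have "A (E i x) = \<theta> i \<odot>\<^bsub>V\<^esub> E i x" if x: "x \<in> carrier V" for x
    proof -
      obtain c where c: "c \<in> carrier K" "E i x = c \<odot>\<^bsub>V\<^esub> u i" using u.proj_scalar[OF i x] by blast
      have "A (c \<odot>\<^bsub>V\<^esub> u i) = c \<odot>\<^bsub>V\<^esub> (\<theta> i \<odot>\<^bsub>V\<^esub> u i)"
        using End_smult[OF vsV A c(1) u.frame_carrier[OF i]] \<theta>(2)[OF i] by simp
      also have "\<dots> = \<theta> i \<odot>\<^bsub>V\<^esub> (c \<odot>\<^bsub>V\<^esub> u i)"
        using u.smult_assoc1[OF c(1) \<theta>(1)[OF i] u.frame_carrier[OF i]]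
          u.smult_assoc1[OF \<theta>(1)[OF i] c(1) u.frame_carrier[OF i]]
          u.m_comm[OF c(1) \<theta>(1)[OF i]] by simp
      finally show ?thesis using c(2) by simp
    qed
    then have "A \<otimes>\<^bsub>End_alg K V\<^esub> E i = \<theta> i \<odot>\<^bsub>End_alg K V\<^esub> E i"
      by (intro ext) (simp add: End_alg_simps(2,6) compose_def)
    then have "\<gamma> A \<otimes>\<^bsub>End_alg K W\<^esub> F i = \<theta> i \<odot>\<^bsub>End_alg K W\<^esub> F i"
      using End_alg_isoD(3)[OF \<gamma> A Ei] End_alg_isoD(5)[OF \<gamma> \<theta>(1)[OF i] Ei] F[OF i] by simp
    then have "(\<gamma> A \<otimes>\<^bsub>End_alg K W\<^esub> F i) (r i) = (\<theta> i \<odot>\<^bsub>End_alg K W\<^esub> F i) (r i)" by simp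
    then show ?thesis
      using r.frame_carrier[OF i] r.proj_frame[OF i i] by (simp add: End_alg_simps(2,6) compose_def)
  qed
  have comm: "\<gamma> A (B x) = B (\<gamma> A x)" if x: "x \<in> carrier W" for x
  proof -
    have "(\<gamma> A \<otimes>\<^bsub>End_alg K W\<^esub> B) x = (B \<otimes>\<^bsub>End_alg K W\<^esub> \<gamma> A) x"
    proof (rule r.hom_eq_on_frame[OF _ _ _ x])
      show "\<gamma> A \<otimes>\<^bsub>End_alg K W\<^esub> B \<in> module_hom K W W" "B \<otimes>\<^bsub>End_alg K W\<^esub> \<gamma> A \<in> module_hom K W W"
        by (intro End_alg_homD End_mult_closed vsW \<gamma>A B)+
      show "(\<gamma> A \<otimes>\<^bsub>End_alg K W\<^esub> B) (r i) = (B \<otimes>\<^bsub>End_alg K W\<^esub> \<gamma> A) (r i)" if i: "i \<le> d" for i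
      proof -
        note ri = r.frame_carrier[OF i]
        have "\<gamma> A (B (r i)) = \<eta> i \<odot>\<^bsub>W\<^esub> (\<theta> i \<odot>\<^bsub>W\<^esub> r i)"
          using \<eta>(2)[OF i] End_smult[OF vsW \<gamma>A \<eta>(1)[OF i] ri] \<gamma>A_r[OF i] by simp
        also have "\<dots> = \<theta> i \<odot>\<^bsub>W\<^esub> (\<eta> i \<odot>\<^bsub>W\<^esub> r i)"
          using r.smult_assoc1[OF \<eta>(1)[OF i] \<theta>(1)[OF i] ri]
            r.smult_assoc1[OF \<theta>(1)[OF i] \<eta>(1)[OF i] ri] u.m_comm[OF \<eta>(1)[OF i] \<theta>(1)[OF i]] by simp
        also have "\<dots> = B (\<gamma> A (r i))"
          using \<eta>(2)[OF i] End_smult[OF vsW B \<theta>(1)[OF i] ri] \<gamma>A_r[OF i] by simp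
        finally show ?thesis using ri by (simp add: End_alg_simps(2) compose_def)
      qed
    qed
    then show ?thesis using x by (simp add: End_alg_simps(2) compose_def)
  qed
  have "hessenberg K W d Fs (\<gamma> A)"
    using End_alg_iso_hessenberg[OF vsV vsW \<gamma> hA A _ Fs]
      TH_system_idempotent_closed[OF is_TH_system_swap[OF THV]] by blast
  from w.commuting_hessenberg_affine[OF B \<gamma>A hB this comm] show ?thesis .
qed

lemma RTH_iso_rel_equiv: "equiv (RTH_systems K d) (RTH_iso_rel K d)"
proof (rule equivI)
  have closed: "E i \<in> carrier (End_alg K V)" "Es i \<in> carrier (End_alg K V)" "vectorspace K V"
    if "(V, E, Es) \<in> RTH_systems K d" "i \<le> d" for V E Es i
  proof -
    from that(1) obtain A As where TH: "is_TH_system K d V A E As Es"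
      unfolding RTH_systems_def by blast
    show "E i \<in> carrier (End_alg K V)" by (rule TH_system_idempotent_closed[OF TH that(2)])
    show "Es i \<in> carrier (End_alg K V)"
      by (rule TH_system_idempotent_closed[OF is_TH_system_swap[OF TH] that(2)])
    show "vectorspace K V" using TH unfolding is_TH_system_iff by blast
  qed
  show "RTH_iso_rel K d \<subseteq> RTH_systems K d \<times> RTH_systems K d"
    unfolding RTH_iso_rel_def by blast
  show "refl_on (RTH_systems K d) (RTH_iso_rel K d)"
  proof (rule refl_onI)
    fix \<Theta> assume \<Theta>: "\<Theta> \<in> RTH_systems K d"
    obtain V E Es where eq: "\<Theta> = (V, E, Es)" by (cases \<Theta>)
    have "RTH_isomorphic K d \<Theta> \<Theta>"
      unfolding RTH_isomorphic_def eq using End_alg_iso_refl[of K V] by auto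
    then show "(\<Theta>, \<Theta>) \<in> RTH_iso_rel K d" using \<Theta> unfolding RTH_iso_rel_def by blast
  qed
  show "sym (RTH_iso_rel K d)"
  proof (rule symI)
    fix \<Theta> \<Theta>' assume rel: "(\<Theta>, \<Theta>') \<in> RTH_iso_rel K d"
    obtain V E Es where eq: "\<Theta> = (V, E, Es)" by (cases \<Theta>)
    obtain W F Fs where eq': "\<Theta>' = (W, F, Fs)" by (cases \<Theta>')
    have \<Theta>: "(V, E, Es) \<in> RTH_systems K d" using rel eq unfolding RTH_iso_rel_def by blast
    obtain \<gamma> where \<gamma>: "\<gamma> \<in> End_alg_iso K V W"
      and F: "\<And>i. i \<le> d \<Longrightarrow> F i = \<gamma> (E i) \<and> Fs i = \<gamma> (Es i)"
      using rel unfolding RTH_iso_rel_def RTH_isomorphic_def eq eq' by blast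
    let ?h = "the_inv_into (carrier (End_alg K V)) \<gamma>"
    have vs: "vectorspace K V" by (rule closed(3)[OF \<Theta> le0])
    have "?h \<in> End_alg_iso K W V" by (rule End_alg_iso_sym[OF vs \<gamma>])
    moreover have "E i = ?h (F i) \<and> Es i = ?h (Fs i)" if i: "i \<le> d" for i
      using the_inv_into_f_f[OF bij_betw_imp_inj_on[OF End_alg_isoD(1)[OF \<gamma>]]]
        closed(1,2)[OF \<Theta> i] F[OF i] by simp
    ultimately have "RTH_isomorphic K d \<Theta>' \<Theta>"
      unfolding RTH_isomorphic_def eq eq' by blast
    then show "(\<Theta>', \<Theta>) \<in> RTH_iso_rel K d" using rel unfolding RTH_iso_rel_def by blast
  qed
  show "trans (RTH_iso_rel K d)"
  proof (rule transI)
    fix \<Theta>1 \<Theta>2 \<Theta>3 assume rel: "(\<Theta>1, \<Theta>2) \<in> RTH_iso_rel K d" "(\<Theta>2, \<Theta>3) \<in> RTH_iso_rel K d"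
    obtain V E Es where eq1: "\<Theta>1 = (V, E, Es)" by (cases \<Theta>1)
    obtain W F Fs where eq2: "\<Theta>2 = (W, F, Fs)" by (cases \<Theta>2)
    obtain X G Gs where eq3: "\<Theta>3 = (X, G, Gs)" by (cases \<Theta>3)
    obtain \<gamma> where \<gamma>: "\<gamma> \<in> End_alg_iso K V W"
      and F: "\<And>i. i \<le> d \<Longrightarrow> F i = \<gamma> (E i) \<and> Fs i = \<gamma> (Es i)"
      using rel(1) unfolding RTH_iso_rel_def RTH_isomorphic_def eq1 eq2 by blast
    obtain \<delta> where \<delta>: "\<delta> \<in> End_alg_iso K W X"
      and G: "\<And>i. i \<le> d \<Longrightarrow> G i = \<delta> (F i) \<and> Gs i = \<delta> (Fs i)"
      using rel(2) unfolding RTH_iso_rel_def RTH_isomorphic_def eq2 eq3 by blast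
    have "RTH_isomorphic K d \<Theta>1 \<Theta>3"
      unfolding RTH_isomorphic_def eq1 eq3 prod.case
      by (rule bexI[OF _ End_alg_iso_trans[OF \<gamma> \<delta>]]) (simp add: F G)
    then show "(\<Theta>1, \<Theta>3) \<in> RTH_iso_rel K d" using rel unfolding RTH_iso_rel_def by blast
  qed
qed

lemma reduction_of_TH_systems: "reduction ` TH_systems K d = RTH_systems K d"
proof (intro equalityI subsetI)
  fix \<Theta> assume "\<Theta> \<in> RTH_systems K d"
  then obtain V A E As Es where "is_TH_system K d V A E As Es" and \<Theta>: "\<Theta> = (V, E, Es)"
    unfolding RTH_systems_def by blast
  then have "(V, A, E, As, Es) \<in> TH_systems K d" unfolding TH_systems_def by blast
  moreover have "\<Theta> = reduction (V, A, E, As, Es)" unfolding \<Theta> reduction_def by simp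
  ultimately show "\<Theta> \<in> reduction ` TH_systems K d" by (rule rev_image_eqI)
qed (auto simp: TH_systems_def RTH_systems_def reduction_def)

text \<open>
  From left to right the same \<open>\<gamma>\<close> serves, as affine transformations leave the idempotents alone. From
  right to left, \<open>\<gamma>\<close> carries the first system to the affine transformation of the second one whose
  coefficients come from comparing \<open>\<gamma> A\<close> with \<open>B\<close> and \<open>\<gamma> As\<close> with \<open>Bs\<close>.
\<close>

lemma affine_iso_rel_iff_reductions:
  "(\<Phi>, \<Phi>') \<in> affine_iso_rel K d \<longleftrightarrow>
    \<Phi> \<in> TH_systems K d \<and> \<Phi>' \<in> TH_systems K d \<and>
    (reduction \<Phi>, reduction \<Phi>') \<in> RTH_iso_rel K d"
proof -
  obtain V A E As Es where eq: "\<Phi> = (V, A, E, As, Es)" by (cases \<Phi>)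
  obtain W B F Bs Fs where eq': "\<Phi>' = (W, B, F, Bs, Fs)" by (cases \<Phi>')
  have red: "reduction \<Phi> = (V, E, Es)" "reduction \<Phi>' = (W, F, Fs)"
    unfolding eq eq' reduction_def by auto
  have "(\<exists>\<Psi> \<in> affine_transformations K d \<Phi>'. TH_isomorphic K d \<Phi> \<Psi>) \<longleftrightarrow>
      RTH_isomorphic K d (V, E, Es) (W, F, Fs)"
    if \<Phi>: "\<Phi> \<in> TH_systems K d" and \<Phi>': "\<Phi>' \<in> TH_systems K d"
  proof
    assume "\<exists>\<Psi> \<in> affine_transformations K d \<Phi>'. TH_isomorphic K d \<Phi> \<Psi>"
    then show "RTH_isomorphic K d (V, E, Es) (W, F, Fs)"
      unfolding eq eq' affine_transformations_def TH_isomorphic_def RTH_isomorphic_def by auto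
  next
    assume "RTH_isomorphic K d (V, E, Es) (W, F, Fs)"
    then obtain \<gamma> where \<gamma>: "\<gamma> \<in> End_alg_iso K V W"
      and F: "\<And>i. i \<le> d \<Longrightarrow> F i = \<gamma> (E i)" and Fs: "\<And>i. i \<le> d \<Longrightarrow> Fs i = \<gamma> (Es i)"
      unfolding RTH_isomorphic_def by auto
    have THV: "is_TH_system K d V A E As Es" and THW: "is_TH_system K d W B F Bs Fs"
      using \<Phi> \<Phi>' unfolding eq eq' TH_systems_def by auto
    obtain \<alpha> \<beta> where \<alpha>: "\<alpha> \<in> carrier K - {\<zero>\<^bsub>K\<^esub>}" "\<beta> \<in> carrier K"
      and A: "\<gamma> A = affine_map K W \<alpha> \<beta> B"
      using transported_map_affine[OF THV THW \<gamma>, OF F Fs] by blast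
    obtain \<alpha>s \<beta>s where \<alpha>s: "\<alpha>s \<in> carrier K - {\<zero>\<^bsub>K\<^esub>}" "\<beta>s \<in> carrier K"
      and As: "\<gamma> As = affine_map K W \<alpha>s \<beta>s Bs"
      using transported_map_affine[OF is_TH_system_swap[OF THV] is_TH_system_swap[OF THW] \<gamma>, OF Fs F] by blast
    let ?\<Psi> = "(W, affine_map K W \<alpha> \<beta> B, F, affine_map K W \<alpha>s \<beta>s Bs, Fs)"
    have "?\<Psi> \<in> TH_systems K d"
      using is_TH_system_affine[OF THW \<alpha> \<alpha>s] unfolding TH_systems_def by simp
    then have "?\<Psi> \<in> affine_transformations K d \<Phi>'"
      unfolding affine_transformations_def eq' using \<alpha> \<alpha>s by blast
    moreover have "TH_isomorphic K d \<Phi> ?\<Psi>"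
      unfolding TH_isomorphic_def eq prod.case using \<gamma> A As F Fs by (intro bexI[of _ \<gamma>]) auto
    ultimately show "\<exists>\<Psi> \<in> affine_transformations K d \<Phi>'. TH_isomorphic K d \<Phi> \<Psi>" by blast
  qed
  then show ?thesis
    using reduction_of_TH_systems[of K d]
    unfolding affine_iso_rel_def RTH_iso_rel_def red[symmetric] by blast
qed

text \<open>
Pulling an equivalence relation back along a surjection does not change the classes, up to
bijection. The bijection sends a class to the saturation of its image, which avoids choosing representatives.
\<close>

lemma quotient_bij_of_pullback:
  assumes S: "equiv Y S" and onto: "r ` X = Y"
    and R: "\<And>x y. (x, y) \<in> R \<longleftrightarrow> x \<in> X \<and> y \<in> X \<and> (r x, r y) \<in> S"
  shows "\<exists>f. (\<forall>x \<in> X. f (R `` {x}) = S `` {r x}) \<and> bij_betw f (X // R) (Y // S)"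
proof -
  let ?f = "\<lambda>C. S `` (r ` C)"
  have S_trans: "trans S" and S_refl: "refl_on Y S"
    using S unfolding equiv_def by auto
  have f: "?f (R `` {x}) = S `` {r x}" if x: "x \<in> X" for x
  proof -
    have "r x \<in> Y" using x onto by blast
    then have refl: "(r x, r x) \<in> S" using S_refl by (rule refl_onD[rotated])
    show ?thesis
    proof (intro equalityI subsetI)
      fix z assume "z \<in> S `` (r ` (R `` {x}))"
      then obtain y where "(r x, r y) \<in> S" "(r y, z) \<in> S" using R by blast
      then show "z \<in> S `` {r x}" using transD[OF S_trans] by blast
    next
      fix z assume "z \<in> S `` {r x}"
      moreover have "x \<in> R `` {x}" using R x refl by blast
      ultimately show "z \<in> S `` (r ` (R `` {x}))" by blast
    qed
  qed
  have "bij_betw ?f (X // R) (Y // S)"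
  proof (rule bij_betw_imageI)
    show "inj_on ?f (X // R)"
    proof (rule inj_onI)
      fix C D assume "C \<in> X // R" "D \<in> X // R" and eq: "?f C = ?f D"
      then obtain x y where x: "x \<in> X" "C = R `` {x}" and y: "y \<in> X" "D = R `` {y}"
        by (auto elim!: quotientE)
      have "S `` {r x} = S `` {r y}" using eq f x y by simp
      then have "(r x, r z) \<in> S \<longleftrightarrow> (r y, r z) \<in> S" for z by blast
      then show "C = D" using R x y by auto
    qed
    have "?f ` (X // R) = (\<lambda>x. ?f (R `` {x})) ` X"
      unfolding quotient_def by auto
    also have "\<dots> = (\<lambda>x. S `` {r x}) ` X" by (rule image_cong[OF refl f])
    also have "\<dots> = Y // S" unfolding quotient_def onto[symmetric] by auto
    finally show "?f ` (X // R) = Y // S" .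
  qed
  with f show ?thesis by (intro exI[of _ ?f] conjI ballI)
qed

theorem corollary19p5:
  fixes K :: "('k, 'm) ring_scheme" and d :: nat
  assumes "field K"
  shows "\<exists>f :: ('k, 'v) th_system set \<Rightarrow> ('k, 'v) rth_system set.
    (\<forall>\<Phi> \<in> TH_systems K d. f (affine_iso_rel K d `` {\<Phi>}) = RTH_iso_rel K d `` {reduction \<Phi>}) \<and>
    bij_betw f (TH_systems K d // affine_iso_rel K d) (RTH_systems K d // RTH_iso_rel K d)"
  by (rule quotient_bij_of_pullback[OF RTH_iso_rel_equiv reduction_of_TH_systems
        affine_iso_rel_iff_reductions])

end
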